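(* Let $N\ge 2$ and $1\le k\le N-1$ be integers. Let $X_0=N$ and let $X_1,X_2,\ldots$ be independent random variables, each uniformly distributed on $[N]$. Let $\zeta_{N,k}$ be the first time $t$ with $X_t\in[k]$, let $\lambda_{N,k}=L_{\zeta_{N,k}}$ be the length of the loop-erased walk derived from $(X_n)$ at time $\zeta_{N,k}$, and let $R_N$ be the first repeat time of the same sequence. Then $\lambda_{N,k}$ has the same distribution as $R_N-k$ conditioned on $R_N>k$; that is, for every $1\le j\le N-k$, $$\mathbb{P}(\lambda_{N,k}=j)=\mathbb{P}(R_N-k=j\mid R_N>k)=\frac{(k+j)\,(N-k-1)_{j-1}}{N^j}.$$ Moreover, in the colored loop-erased walk of length $\lambda_{N,k}$ obtained by stopping at time $\zeta_{N,k}$, let $B_i$ denote the event that the $i$-th and $(i+1)$-th edges of the loop-erased walk are colored differently. Then, given $\lambda_{N,k}=j$ (for $1\le j\le N-k$), the events $B_i$ for $1\le i\le j-1$ are (conditionally) independent, with $$\mathbb{P}(B_i\mid\lambda_{N,k}=j)=\frac{1}{k+i+1}.$$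
   Context: Notation: $[m]=\{1,\ldots,m\}$; $(a)_b=a(a-1)\cdots(a-b+1)$ for $b\ge 1$ and $(a)_0=1$. Loop-erased walk: given a sequence $(X_n)_{n\ge 0}$, define finite sequences $\mathcal{L}_n=(Y_{n,0},\ldots,Y_{n,L_n})$ inductively. Set $\mathcal{L}_0=(X_0)$, $L_0=0$. If $X_n$ is not among the terms of $\mathcal{L}_{n-1}$, then $\mathcal{L}_n$ is obtained by appending $X_n$ to $\mathcal{L}_{n-1}$, so $L_n=L_{n-1}+1$. If $X_n=Y_{n-1,j}$ for some $0\le j\le L_{n-1}$, then $\mathcal{L}_n=(Y_{n-1,0},\ldots,Y_{n-1,j})$ and $L_n=j$; in this case a loop is said to occur at time $n$ (this includes the case $X_n=X_{n-1}$). $L_n$ is the length (number of edges) of the loop-erased walk at time $n$; its $i$-th edge is $(Y_{n,i-1},Y_{n,i})$, $1\le i\le L_n$. Coloring: there is an infinite palette of distinct colors $C_1,C_2,\ldots$. Every edge appended to the walk is painted with the current color, which is $C_1$ initially; each time a loop occurs, the edges beyond the truncation point are erased, remaining edges keep their colors, and the current color changes from $C_i$ to $C_{i+1}$. (So an edge appended at time $n$ has color $C_{1+m}$, where $m$ is the number of loops that occurred at times before $n$.) First repeat time: $R_N=\min\{i\ge 1: X_i\in\{X_0,\ldots,X_{i-1}\}\}$. *)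

theory Defs
  imports "HOL-Probability.Probability"
begin

definition falling_factorial :: "'a::comm_ring_1 \<Rightarrow> nat \<Rightarrow> 'a" where
  "falling_factorial a b = (\<Prod>i<b. a - of_nat i)"

text \<open>
  The sequence is a function on \<^typ>\<open>nat\<close>. The loop-erased walk at time \<open>n\<close> is the vertex list
  \<open>[Y 0, \<dots>, Y L]\<close>, so its number of edges is one less than the length of the list.
\<close>

primrec lew :: "(nat \<Rightarrow> 'a) \<Rightarrow> nat \<Rightarrow> 'a list" where
  "lew x 0 = [x 0]"
| "lew x (Suc n) =
     (if x (Suc n) \<in> set (lew x n)
      then take (Suc (LEAST j. j < length (lew x n) \<and> lew x n ! j = x (Suc n))) (lew x n)
      else lew x n @ [x (Suc n)])"

definition lew_length :: "(nat \<Rightarrow> 'a) \<Rightarrow> nat \<Rightarrow> nat" where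
  "lew_length x n = length (lew x n) - 1"

definition loop_at :: "(nat \<Rightarrow> 'a) \<Rightarrow> nat \<Rightarrow> bool" where
  "loop_at x n \<longleftrightarrow> n \<ge> 1 \<and> x n \<in> set (lew x (n - 1))"

text \<open>
  The colour \<open>C i\<close> of the palette is represented by the number \<open>i\<close>; \<open>current_colour x n\<close> is the
  colour in force after time \<open>n\<close>, i.e. the one used for an edge appended at time \<open>n + 1\<close>.
  The list \<open>edge_colours x n\<close> gives the colours of the edges of \<open>lew x n\<close> in order, so the
  \<open>i\<close>-th edge (with \<open>i \<ge> 1\<close>) has colour \<open>edge_colours x n ! (i - 1)\<close>.
\<close>

primrec current_colour :: "(nat \<Rightarrow> 'a) \<Rightarrow> nat \<Rightarrow> nat" where
  "current_colour x 0 = 1"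
| "current_colour x (Suc n) =
     (if loop_at x (Suc n) then Suc (current_colour x n) else current_colour x n)"

primrec edge_colours :: "(nat \<Rightarrow> 'a) \<Rightarrow> nat \<Rightarrow> nat list" where
  "edge_colours x 0 = []"
| "edge_colours x (Suc n) =
     (if loop_at x (Suc n)
      then take (lew_length x (Suc n)) (edge_colours x n)
      else edge_colours x n @ [current_colour x n])"

text \<open>
  The two times below are totalised by \<^const>\<open>Least\<close>: if the time does not exist, which for
  independent uniform steps happens only on a null set, the value is an unspecified number
  that does not depend on the sequence.
\<close>

definition hitting_time :: "nat \<Rightarrow> (nat \<Rightarrow> nat) \<Rightarrow> nat" where
  "hitting_time k x = (LEAST t. x t \<in> {1..k})"

definition first_repeat :: "(nat \<Rightarrow> 'a) \<Rightarrow> nat" where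
  "first_repeat x = (LEAST i. i \<ge> 1 \<and> x i \<in> x ` {..<i})"

definition stopped_length :: "nat \<Rightarrow> (nat \<Rightarrow> nat) \<Rightarrow> nat" where
  "stopped_length k x = lew_length x (hitting_time k x)"

text \<open>The \<open>i\<close>-th and \<open>(i + 1)\<close>-th edges both exist and have different colours.\<close>

definition colour_change :: "nat \<Rightarrow> (nat \<Rightarrow> nat) \<Rightarrow> nat \<Rightarrow> bool" where
  "colour_change k x i \<longleftrightarrow>
     1 \<le> i \<and> i + 1 \<le> stopped_length k x \<and>
     edge_colours x (hitting_time k x) ! (i - 1) \<noteq> edge_colours x (hitting_time k x) ! i"

end

theory Submission
  imports Defs "HOL-Library.Sublist"
begin

text \<open>
  The coloured walk before time \<open>\<zeta>\<close> is summarised by a list of Booleans, one flag for each edge: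
  flag \<open>i\<close> says whether edge \<open>i\<close> and its successor have different colours, where the successor of
  the last edge is the edge that would be appended next, in the current colour
  (\<open>change_flags\<close>). A loop back to level \<open>l\<close> keeps the first \<open>l - 1\<close> flags and sets
  the \<open>l\<close>-th one, because the colour in force afterwards is a new one; an appended edge adds an unset
  flag, because it has the current colour. Hence for a uniform walk the list is itself a Markov
  chain, killed with probability \<open>k/N\<close>: with \<open>m = N - k\<close>, from a list \<open>w\<close> it moves to \<open>w @ [False]\<close> with
  probability \<open>(m - 1 - |w|)/N\<close>, and to \<open>[]\<close> and to each \<open>u @ [True]\<close> with \<open>u\<close> a strict prefix of
  \<open>w\<close> with probability \<open>1/N\<close>. At the killing step one last edge is appended, so that \<open>\<lambda> = |w| + 1\<close>
  and the flags in \<open>w\<close> are exactly the events \<open>B i\<close>.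

  The expected number of visits of this chain to \<open>w\<close> has the explicit form \<open>green w\<close>,
  the product of a function of \<open>|w|\<close> with one factor for each flag; the joint law at the killing time
  is \<open>green w \<cdot> k/N\<close>, which gives both the law of \<open>\<lambda>\<close> and the conditional independence of the flags.
  The formula comes from Wilson's description of loop-erased walk: while the walk is at level \<open>i\<close>,
  it returns to this level before it is absorbed by \<open>[k]\<close> or by one of the \<open>i\<close> lower levels with
  probability \<open>1/(k + i + 1)\<close>, and the flag of the level is set iff there is at least one such return.
  It is verified here without path decompositions. The function \<open>green\<close> solves the
  balance equations of the chain (\<open>green_snoc\<close>, \<open>sum_green_extensions\<close>), hence
  dominates the expected numbers of visits; its total mass \<open>N/k\<close> is the expected killing time, so
  it equals them (\<open>sums_green\<close>).

  Every one-step probability comes from one counting principle (\<open>prob_step\<close>): if, given the past,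
  exactly \<open>c\<close> values of the next step are favourable, the probability is multiplied by \<open>c/N\<close>. The
  same principle gives the law of the first repeat time, and the two laws are compared explicitly.
\<close>

section \<open>Loop-erased walks and their colour changes\<close>

lemma lew_nonempty: "lew x n \<noteq> []"
  by (induction n) auto

lemma length_lew: "length (lew x n) = Suc (lew_length x n)"
  using lew_nonempty[of x n] by (simp add: lew_length_def)

lemma lew_distinct: "distinct (lew x n)"
  by (induction n) auto

lemma set_lew_subset: "set (lew x n) \<subseteq> x ` {..n}"
proof (induction n)
  case (Suc n)
  then show ?case
    by (auto dest!: in_set_takeD simp: atMost_Suc)
qed auto

lemma lew_nth_0: "lew x n ! 0 = x 0"
  by (induction n) (auto simp: nth_append lew_nonempty)

lemma lew_step_loop:
  assumes "l \<le> lew_length x n" "x (Suc n) = lew x n ! l"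
  shows "lew x (Suc n) = take (Suc l) (lew x n)" "loop_at x (Suc n)" "lew_length x (Suc n) = l"
proof -
  have "(LEAST j. j < length (lew x n) \<and> lew x n ! j = x (Suc n)) = l"
    using assms lew_distinct[of x n] length_lew[of x n]
    by (intro Least_equality) (auto simp: nth_eq_iff_index_eq)
  moreover have mem: "x (Suc n) \<in> set (lew x n)"
    using assms length_lew[of x n] by auto
  ultimately show *: "lew x (Suc n) = take (Suc l) (lew x n)"
    by (simp only: lew.simps if_True)
  show "loop_at x (Suc n)"
    using mem by (simp add: loop_at_def)
  from * show "lew_length x (Suc n) = l"
    using assms(1) by (simp only: lew_length_def) (simp add: length_lew)
qed

lemma lew_step_new:
  assumes "x (Suc n) \<notin> set (lew x n)"
  shows "lew x (Suc n) = lew x n @ [x (Suc n)]" "\<not> loop_at x (Suc n)"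
    "lew_length x (Suc n) = Suc (lew_length x n)"
  using assms length_lew[of x n] by (auto simp: loop_at_def lew_length_def)

declare lew.simps(2) [simp del]

lemma lew_step_cases:
  obtains (new) "x (Suc n) \<notin> set (lew x n)"
    | (loop) l where "l \<le> lew_length x n" "x (Suc n) = lew x n ! l"
proof (cases "x (Suc n) \<in> set (lew x n)")
  case True
  then obtain l where "l < length (lew x n)" "x (Suc n) = lew x n ! l"
    by (metis in_set_conv_nth)
  then show ?thesis
    using loop[of l] length_lew[of x n] by simp
qed (use new in blast)

lemma length_edge_colours: "length (edge_colours x n) = lew_length x n"
proof (induction n)
  case (Suc n)
  show ?case
  proof (rule lew_step_cases[of x n])
    assume "x (Suc n) \<notin> set (lew x n)"
    then show ?thesis
      using Suc by (simp add: lew_step_new)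
  next
    fix l assume "l \<le> lew_length x n" "x (Suc n) = lew x n ! l"
    note lew_step_loop[OF this]
    then show ?thesis
      using Suc \<open>l \<le> _\<close> by simp
  qed
qed (simp add: lew_length_def)

lemma edge_colours_le_current:
  "c \<in> set (edge_colours x n) \<Longrightarrow> c \<le> current_colour x n"
proof (induction n)
  case (Suc n)
  then have "c \<in> set (edge_colours x n) \<or> c = current_colour x n"
    by (auto dest: in_set_takeD split: if_splits)
  then have "c \<le> current_colour x n"
    using Suc.IH by blast
  then show ?case
    by simp
qed simp

text \<open>
  The current colour is appended to the list of edge colours so that the last edge has a flag too,
  which compares it with the edge that would be appended next. This makes the flags
  at time \<open>n + 1\<close> a function of the flags at time \<open>n\<close> and the level of the walk that is hit.
\<close>

definition change_flags :: "(nat \<Rightarrow> 'a) \<Rightarrow> nat \<Rightarrow> bool list" where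
  "change_flags x n =
     map (\<lambda>i. edge_colours x n ! i \<noteq> (edge_colours x n @ [current_colour x n]) ! Suc i)
       [0..<lew_length x n]"

lemma length_change_flags: "length (change_flags x n) = lew_length x n"
  by (simp add: change_flags_def)

lemma change_flags_0: "change_flags x 0 = []"
  by (simp add: change_flags_def lew_length_def)

lemma change_flags_new:
  assumes "x (Suc n) \<notin> set (lew x n)"
  shows "change_flags x (Suc n) = change_flags x n @ [False]"
proof (rule nth_equalityI)
  note step = lew_step_new[OF assms]
  show "length (change_flags x (Suc n)) = length (change_flags x n @ [False])"
    by (simp add: length_change_flags step)
  fix i assume "i < length (change_flags x (Suc n))"
  then have i: "i < lew_length x n \<or> i = lew_length x n"
    by (auto simp: length_change_flags step)
  have ec: "edge_colours x (Suc n) = edge_colours x n @ [current_colour x n]"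
    "current_colour x (Suc n) = current_colour x n"
    using step(2) by simp_all
  show "change_flags x (Suc n) ! i = (change_flags x n @ [False]) ! i"
    unfolding change_flags_def ec step(3)
    using i length_edge_colours[of x n]
    by (elim disjE) (simp_all add: nth_append)
qed

text \<open>
  The colour in force after a loop exceeds every colour on the walk, so the flag of the edge that
  has become the last one is set whatever it was before.
\<close>

lemma change_flags_loop:
  assumes "l \<le> lew_length x n" "x (Suc n) = lew x n ! l"
  shows "change_flags x (Suc n) =
    (if l = 0 then [] else take (l - 1) (change_flags x n) @ [True])"
proof (rule nth_equalityI)
  note step = lew_step_loop[OF assms]
  show "length (change_flags x (Suc n)) =
    length (if l = 0 then [] else take (l - 1) (change_flags x n) @ [True])"
    using assms by (simp add: length_change_flags step)
  fix i assume "i < length (change_flags x (Suc n))"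
  then have i: "i < l"
    by (simp add: length_change_flags step)
  have le: "edge_colours x n ! i \<le> current_colour x n"
    using i assms(1) by (intro edge_colours_le_current) (simp add: length_edge_colours)
  have ec: "edge_colours x (Suc n) = take l (edge_colours x n)"
    "current_colour x (Suc n) = Suc (current_colour x n)"
    using step(2,3) by simp_all
  show "change_flags x (Suc n) ! i =
    (if l = 0 then [] else take (l - 1) (change_flags x n) @ [True]) ! i"
    unfolding change_flags_def ec step(3)
    using i assms(1) le length_edge_colours[of x n]
    by (cases "Suc i = l") (auto simp: nth_append)
qed

definition avoids :: "nat \<Rightarrow> (nat \<Rightarrow> nat) \<Rightarrow> nat \<Rightarrow> bool" where
  "avoids k x n \<longleftrightarrow> (\<forall>i\<le>n. x i \<notin> {1..k})"

lemma avoids_Suc: "avoids k x (Suc n) \<longleftrightarrow> avoids k x n \<and> x (Suc n) \<notin> {1..k}"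
  by (auto simp: avoids_def le_Suc_eq)

lemma avoids_lew: "avoids k x n \<Longrightarrow> set (lew x n) \<inter> {1..k} = {}"
  using set_lew_subset[of x n] by (force simp: avoids_def)

lemma hitting_time_eq:
  assumes "avoids k x n" "x (Suc n) \<in> {1..k}"
  shows "hitting_time k x = Suc n"
  unfolding hitting_time_def
  using assms by (intro Least_equality) (auto simp: avoids_def not_less_eq_eq[symmetric])

text \<open>
  The step that enters \<open>{1..k}\<close> hits a new vertex, so it appends an edge in the current colour. The
  flags just before this step thus become the colour changes of the stopped walk, and its length exceeds
  their number by one.
\<close>

lemma
  assumes "avoids k x n" "x (Suc n) \<in> {1..k}"
  shows stopped_length_eq: "stopped_length k x = Suc (length (change_flags x n))"
    and colour_change_eq: "colour_change k x i \<longleftrightarrow>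
      1 \<le> i \<and> i \<le> length (change_flags x n) \<and> change_flags x n ! (i - 1)"
proof -
  have new: "x (Suc n) \<notin> set (lew x n)"
    using avoids_lew[OF assms(1)] assms(2) by blast
  show sl: "stopped_length k x = Suc (length (change_flags x n))"
    by (simp add: stopped_length_def hitting_time_eq[OF assms] lew_step_new[OF new]
        length_change_flags)
  show "colour_change k x i \<longleftrightarrow>
      1 \<le> i \<and> i \<le> length (change_flags x n) \<and> change_flags x n ! (i - 1)"
    using length_edge_colours[of x n]
    by (auto simp: colour_change_def sl hitting_time_eq[OF assms] lew_step_new(2)[OF new]
        change_flags_def nth_append)
qed

text \<open>
  The transition rule of the chain of flags is needed backwards: for a target list, which lists lead
  to it and by which steps. The target is empty, or ends with an unset flag, or ends with a set one.
\<close>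

lemma change_flags_Suc_Nil:
  "change_flags x (Suc n) = [] \<longleftrightarrow> x (Suc n) = x 0"
proof (rule lew_step_cases[of x n])
  assume "x (Suc n) \<notin> set (lew x n)"
  moreover have "x 0 \<in> set (lew x n)"
    using lew_nth_0[of x n] lew_nonempty[of x n] by (metis length_greater_0_conv nth_mem)
  ultimately show ?thesis
    by (auto simp: change_flags_new)
next
  fix l assume l: "l \<le> lew_length x n" "x (Suc n) = lew x n ! l"
  then have "l = 0 \<longleftrightarrow> x (Suc n) = x 0"
    using lew_nth_0[of x n] lew_distinct[of x n] length_lew[of x n]
    by (metis less_Suc_eq_le nth_eq_iff_index_eq zero_less_Suc)
  then show ?thesis
    using change_flags_loop[OF l] by auto
qed

lemma change_flags_Suc_False:
  "change_flags x (Suc n) = u @ [False] \<longleftrightarrow>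
     change_flags x n = u \<and> x (Suc n) \<notin> set (lew x n)"
proof (rule lew_step_cases[of x n])
  assume "x (Suc n) \<notin> set (lew x n)"
  then show ?thesis
    by (auto simp: change_flags_new)
next
  fix l assume l: "l \<le> lew_length x n" "x (Suc n) = lew x n ! l"
  then have "x (Suc n) \<in> set (lew x n)"
    using length_lew[of x n] by auto
  then show ?thesis
    using change_flags_loop[OF l] by auto
qed

lemma change_flags_Suc_True:
  "change_flags x (Suc n) = u @ [True] \<longleftrightarrow>
     strict_prefix u (change_flags x n) \<and> x (Suc n) = lew x n ! Suc (length u)"
proof (rule lew_step_cases[of x n])
  assume new: "x (Suc n) \<notin> set (lew x n)"
  have "Suc (length u) < length (lew x n)" if "strict_prefix u (change_flags x n)"
    using prefix_length_less[OF that] by (simp add: length_lew length_change_flags)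
  then show ?thesis
    using new by (auto simp: change_flags_new)
next
  fix l assume l: "l \<le> lew_length x n" "x (Suc n) = lew x n ! l"
  show ?thesis
  proof (cases "strict_prefix u (change_flags x n)")
    case True
    then have len: "Suc (length u) \<le> lew_length x n"
      using prefix_length_less by (fastforce simp: length_change_flags)
    then have "lew x n ! l = lew x n ! Suc (length u) \<longleftrightarrow> l = Suc (length u)"
      using l(1) by (intro nth_eq_iff_index_eq lew_distinct) (auto simp: length_lew)
    moreover have "take (length u) (change_flags x n) = u"
      using True by (auto simp: strict_prefix_def prefix_def)
    moreover have "take (l - 1) (change_flags x n) \<noteq> u" if "l \<noteq> Suc (length u)" "l \<noteq> 0"
      using that l(1) len by (auto simp: length_change_flags)
    ultimately show ?thesis
      using True l(2) change_flags_loop[OF l] by auto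
  next
    case False
    have "strict_prefix (take (l - 1) (change_flags x n)) (change_flags x n)" if "l \<noteq> 0"
      using that l(1) take_is_prefix[of "l - 1" "change_flags x n"]
      by (auto simp: strict_prefix_def take_all_iff length_change_flags)
    then show ?thesis
      using False change_flags_loop[OF l] by auto
  qed
qed

lemma walk_cong:
  assumes "\<forall>i\<le>n. x i = y i"
  shows "lew x n = lew y n \<and> current_colour x n = current_colour y n
    \<and> edge_colours x n = edge_colours y n"
  using assms
proof (induction n)
  case (Suc n)
  then have IH: "lew x n = lew y n" "current_colour x n = current_colour y n"
    "edge_colours x n = edge_colours y n" and eq: "x (Suc n) = y (Suc n)"
    by auto
  then have L: "lew x (Suc n) = lew y (Suc n)" "loop_at x (Suc n) = loop_at y (Suc n)"
    by (simp_all add: loop_at_def lew.simps)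
  then have "lew_length x (Suc n) = lew_length y (Suc n)"
    by (simp add: lew_length_def)
  then show ?case
    using IH L by simp
qed simp

lemma change_flags_cong:
  assumes "\<forall>i\<le>n. x i = y i"
  shows "change_flags x n = change_flags y n"
  using walk_cong[OF assms] by (simp add: change_flags_def lew_length_def)

lemma avoids_cong:
  assumes "\<forall>i\<le>n. x i = y i"
  shows "avoids k x n = avoids k y n"
  using assms by (simp add: avoids_def)

section \<open>The Green function of the chain of colour changes\<close>

lemma falling_factorial_Suc:
  "falling_factorial a (Suc b) = falling_factorial a b * (a - of_nat b)"
  by (simp add: falling_factorial_def)

lemma falling_factorial_add:
  "falling_factorial a (b + c) = falling_factorial a b * falling_factorial (a - of_nat b) c"
  by (induction c) (simp_all add: falling_factorial_Suc falling_factorial_def diff_diff_eq)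

text \<open>
  Choosing the entries of a Boolean list of length \<open>n\<close> one by one expands the product of the binomials.
  This is what turns a product formula for the weight of a list into independence of its entries.
\<close>

lemma sum_bool_lists_prod:
  fixes \<phi> :: "nat \<Rightarrow> bool \<Rightarrow> 'a::comm_semiring_1"
  shows "(\<Sum>w | length w = n. \<Prod>i<n. \<phi> i (w ! i)) = (\<Prod>i<n. \<phi> i True + \<phi> i False)"
proof (induction n)
  case (Suc n)
  have lists: "{w :: bool list. length w = Suc n} =
      (\<lambda>(u, b). u @ [b]) ` ({u. length u = n} \<times> UNIV)"
    by (auto simp: image_iff length_Suc_conv_rev)
  have inj: "inj_on (\<lambda>(u, b). u @ [b]) ({u :: bool list. length u = n} \<times> UNIV)"
    by (auto simp: inj_on_def)
  have "(\<Sum>w | length w = Suc n. \<Prod>i<Suc n. \<phi> i (w ! i)) =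
      (\<Sum>(u, b)\<in>{u. length u = n} \<times> UNIV. (\<Prod>i<n. \<phi> i (u ! i)) * \<phi> n b)"
    unfolding lists sum.reindex[OF inj]
    by (intro sum.cong) (auto simp: nth_append intro!: arg_cong2[where f = "(*)"] prod.cong)
  also have "\<dots> = (\<Sum>u | length u = n. \<Sum>b\<in>UNIV. (\<Prod>i<n. \<phi> i (u ! i)) * \<phi> n b)"
    by (simp add: sum.cartesian_product)
  also have "\<dots> = (\<Sum>u | length u = n. (\<Prod>i<n. \<phi> i (u ! i)) * (\<phi> n True + \<phi> n False))"
    by (simp add: UNIV_bool distrib_left add.commute)
  also have "\<dots> = (\<Sum>u | length u = n. \<Prod>i<n. \<phi> i (u ! i)) * (\<phi> n True + \<phi> n False)"
    by (simp add: sum_distrib_right)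
  finally show ?case
    by (simp add: Suc.IH)
qed simp

locale walk_parameters =
  fixes N k :: nat
  assumes k_pos: "1 \<le> k" and k_less: "k < N"
begin

text \<open>
  The conditional probability that the flag at list index \<open>i\<close> has value \<open>b\<close>. List index \<open>i\<close> belongs to
  the vertex at level \<open>i + 1\<close>, which is why the denominator is \<open>k + (i + 1) + 1\<close>.
\<close>

definition flag_weight :: "nat \<Rightarrow> bool \<Rightarrow> real" where
  "flag_weight i b = (if b then 1 else real (k + i + 1)) / real (k + i + 2)"

text \<open>
  The common value of \<open>P(\<lambda> = j)\<close> and \<open>P(R - k = j | R > k)\<close>.
\<close>

definition stop_weight :: "nat \<Rightarrow> real" where
  "stop_weight j = real (k + j) * falling_factorial (real N - real k - 1) (j - 1) / real N ^ j"

definition states :: "bool list set" where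
  "states = {w. length w < N - k}"

text \<open>
  A closed form for the expected number of visits to \<open>w\<close>. The walk stops in a visited state with probability
  \<open>k/N\<close>, so the expected number of visits is \<open>N/k\<close> times the probability of stopping with flags \<open>w\<close>.
\<close>

definition green :: "bool list \<Rightarrow> real" where
  "green w = real N / real k * stop_weight (Suc (length w)) *
     (\<Prod>i<length w. flag_weight i (w ! i))"

lemma finite_states [simp]: "finite states"
  by (rule finite_subset[OF _ finite_lists_length_le[of UNIV "N - k"]]) (auto simp: states_def)

lemma finite_length_eq [simp]: "finite {w :: bool list. length w = n}"
  using finite_lists_length_eq[of "UNIV :: bool set" n] by simp

lemma Nil_in_states: "[] \<in> states"
  using k_less by (simp add: states_def)

lemma flag_weight_add: "flag_weight i True + flag_weight i False = 1"
  by (simp add: flag_weight_def field_simps)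

lemma green_Nil: "green [] = real (k + 1) / real k"
  using k_less by (simp add: green_def stop_weight_def falling_factorial_def)

text \<open>
  For \<open>b = False\<close> this is the balance equation at \<open>u @ [False]\<close>, whose only predecessor is \<open>u\<close>.
\<close>

lemma green_snoc:
  "green (u @ [b]) = green u * (real N - real k - 1 - real (length u)) / real N *
     (if b then 1 / real (k + length u + 1) else 1)"
proof -
  have stop: "stop_weight (Suc (Suc n)) = stop_weight (Suc n) *
      (real (k + n + 2) / real (k + n + 1)) * ((real N - real k - 1 - real n) / real N)" for n
    by (simp add: stop_weight_def falling_factorial_Suc mult_ac)
  have weights: "(\<Prod>i<Suc (length u). flag_weight i ((u @ [b]) ! i)) =
      (\<Prod>i<length u. flag_weight i (u ! i)) * flag_weight (length u) b"
    by (simp add: nth_append)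
  have "green (u @ [b]) = real N / real k * (stop_weight (Suc (length u)) *
      (real (k + length u + 2) / real (k + length u + 1)) *
      ((real N - real k - 1 - real (length u)) / real N)) *
      ((\<Prod>i<length u. flag_weight i (u ! i)) * flag_weight (length u) b)"
    unfolding green_def weights[symmetric] stop[symmetric] by simp
  also have "\<dots> = green u * ((real N - real k - 1 - real (length u)) / real N) *
      (real (k + length u + 2) / real (k + length u + 1) * flag_weight (length u) b)"
    by (simp only: green_def mult_ac)
  also have "real (k + length u + 2) / real (k + length u + 1) * flag_weight (length u) b =
      (if b then 1 / real (k + length u + 1) else 1)"
    by (simp add: flag_weight_def)
  finally show ?thesis
    by simp
qed

lemma green_nonneg:
  assumes "w \<in> states"
  shows "0 \<le> green w"
  using assms
proof (induction w rule: rev_induct)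
  case Nil
  show ?case by (simp add: green_Nil)
next
  case (snoc b u)
  then have "0 \<le> green u" "0 \<le> real N - real k - 1 - real (length u)"
    by (auto simp: states_def)
  then show ?case
    by (simp add: green_snoc)
qed

text \<open>
  This is the balance equation at \<open>u @ [True]\<close>: its predecessors are the strict extensions of \<open>u\<close>, each
  with transition probability \<open>1/N\<close>. The induction goes from long lists to short ones and splits the
  strict extensions of \<open>u\<close> according to the flag that follows \<open>u\<close>.
\<close>

lemma sum_green_extensions:
  assumes "u \<in> states"
  shows "(\<Sum>w | w \<in> states \<and> strict_prefix u w. green w) =
    green u * (real N - real k - 1 - real (length u)) / real (k + length u + 1)"
  using assms
proof (induction "N - k - length u" arbitrary: u)
  case 0
  then show ?case by (simp add: states_def)
next
  case (Suc d)
  let ?E = "\<lambda>u. {w. w \<in> states \<and> strict_prefix u w}"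
  show ?case
  proof (cases "Suc (length u) < N - k")
    case False
    then have none: "?E u = {}"
      using prefix_length_less by (force simp: states_def)
    moreover have "real N - real k - 1 - real (length u) = 0"
      using False Suc.prems by (simp add: states_def)
    ultimately show ?thesis
      unfolding none by simp
  next
    case True
    then have child: "u @ [b] \<in> states" for b
      by (simp add: states_def)
    have fin: "finite (?E v)" for v
      by simp
    have split: "?E u = (\<Union>b\<in>UNIV. insert (u @ [b]) (?E (u @ [b])))"
    proof (intro set_eqI iffI)
      fix w assume w: "w \<in> ?E u"
      then obtain b r where "w = u @ b # r"
        by (auto elim: strict_prefixE')
      then have "prefix (u @ [b]) w"
        by simp
      then show "w \<in> (\<Union>b\<in>UNIV. insert (u @ [b]) (?E (u @ [b])))"
        using w by (auto simp: strict_prefix_def)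
    next
      fix w assume "w \<in> (\<Union>b\<in>UNIV. insert (u @ [b]) (?E (u @ [b])))"
      then obtain b where "w \<in> states" "prefix (u @ [b]) w"
        using child by (auto simp: strict_prefix_def)
      then show "w \<in> ?E u"
        by (auto simp: prefix_def strict_prefix_def)
    qed
    \<comment> \<open>With \<open>c\<close> fresh vertices and \<open>l\<close> other ones, each step has \<open>N = c + l\<close> choices; this is the identity that makes the induction close.\<close>
    define c where "c = real N - real k - 1 - real (length u)"
    define l where "l = real (k + length u + 1)"
    have l: "l > 0" and N: "real N = c + l" "real N > 0"
      using k_less by (simp_all add: l_def c_def)
    have below: "(\<Sum>w\<in>?E (u @ [b]). green w) = green (u @ [b]) * (c - 1) / (l + 1)" for b
      using Suc.hyps(1)[of "u @ [b]"] Suc.hyps(2) child[of b]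
      by (simp add: c_def l_def algebra_simps)
    have "(\<Sum>w\<in>?E u. green w) = (\<Sum>b\<in>UNIV. \<Sum>w\<in>insert (u @ [b]) (?E (u @ [b])). green w)"
      unfolding split
      by (rule sum.UNION_disjoint) (use fin in \<open>auto simp: strict_prefix_def prefix_def\<close>)
    also have "\<dots> = (\<Sum>b\<in>UNIV. green (u @ [b]) + green (u @ [b]) * (c - 1) / (l + 1))"
      using fin by (intro sum.cong refl) (simp add: below)
    also have "\<dots> = (\<Sum>b\<in>UNIV. green (u @ [b])) * (1 + (c - 1) / (l + 1))"
      unfolding sum_distrib_right by (simp add: distrib_left)
    also have "(\<Sum>b\<in>UNIV. green (u @ [b])) = green u * c / real N * (1 / l + 1)"
      by (simp add: UNIV_bool green_snoc c_def l_def distrib_left add.commute)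
        (simp add: algebra_simps)
    also have "green u * c / real N * (1 / l + 1) * (1 + (c - 1) / (l + 1)) = green u * c / l"
    proof -
      have "(1 / l + 1) * (1 + (c - 1) / (l + 1)) = real N / l"
        using l unfolding N by (simp add: divide_simps) (simp add: algebra_simps)
      then have "green u * c / real N * ((1 / l + 1) * (1 + (c - 1) / (l + 1))) = green u * c / l"
        using N(2) by simp
      then show ?thesis
        by (simp only: mult.assoc)
    qed
    finally show ?thesis
      by (simp add: c_def l_def)
  qed
qed

lemma sum_green: "(\<Sum>w\<in>states. green w) = real N / real k"
proof -
  have "states = insert [] {w \<in> states. strict_prefix [] w}"
    using Nil_in_states by (auto simp: strict_prefix_def)
  then have "(\<Sum>w\<in>states. green w) = (\<Sum>w\<in>insert [] {w \<in> states. strict_prefix [] w}. green w)"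
    by simp
  also have "\<dots> = green [] + (\<Sum>w | w \<in> states \<and> strict_prefix [] w. green w)"
    by simp
  also have "\<dots> = green [] * (1 + (real N - real k - 1) / real (k + 1))"
    using sum_green_extensions[OF Nil_in_states] by (simp add: distrib_left)
  also have "\<dots> = real N / real k"
    using k_pos by (simp add: green_Nil divide_simps)
  finally show ?thesis .
qed

text \<open>
  The assumptions on \<open>p n w\<close> say that it behaves like the probability of being alive in state \<open>w\<close> at time \<open>n\<close>. Since
  \<open>green\<close> satisfies the same linear recurrence, it bounds all partial sums of \<open>p\<close>. In total, over all states, the
  bound is attained in the limit: the surviving masses form a geometric series with sum \<open>N/k\<close>, the
  total mass of \<open>green\<close>. So it is attained in every single state.
\<close>

lemma sums_green:
  fixes p :: "nat \<Rightarrow> bool list \<Rightarrow> real"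
  assumes nonneg: "\<And>n w. 0 \<le> p n w"
    and start: "\<And>w. p 0 w = (if w = [] then 1 else 0)"
    and to_Nil: "\<And>n. p (Suc n) [] = (\<Sum>w\<in>states. p n w) / real N"
    and to_False: "\<And>n u. u @ [False] \<in> states \<Longrightarrow>
      p (Suc n) (u @ [False]) = p n u * (real N - real k - 1 - real (length u)) / real N"
    and to_True: "\<And>n u. u @ [True] \<in> states \<Longrightarrow>
      p (Suc n) (u @ [True]) = (\<Sum>w | w \<in> states \<and> strict_prefix u w. p n w) / real N"
    and mass: "\<And>n. (\<Sum>w\<in>states. p n w) = (1 - real k / real N) ^ n"
    and w: "w \<in> states"
  shows "(\<lambda>n. p n w) sums green w"
proof -
  define S where "S n w = (\<Sum>i<n. p i w)" for n w
  have N: "real N > 0" and k: "real k > 0"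
    using k_pos k_less by simp_all
  have S_Suc: "S (Suc n) v = p 0 v + (\<Sum>i<n. p (Suc i) v)" for n v
    unfolding S_def by (rule sum.lessThan_Suc_shift)
  have upper: "S n v \<le> green v" if "v \<in> states" for n v
    using that
  proof (induction n arbitrary: v)
    case 0
    then show ?case by (simp add: S_def green_nonneg)
  next
    case (Suc n)
    show ?case
    proof (cases v rule: rev_cases)
      case Nil
      have "S (Suc n) v = 1 + (\<Sum>w\<in>states. S n w) / real N"
        unfolding S_Suc using Nil
        by (simp add: start to_Nil S_def sum_divide_distrib[symmetric] sum.swap[of _ "{..<n}"])
      also have "\<dots> \<le> 1 + (\<Sum>w\<in>states. green w) / real N"
        using Suc.IH N by (simp add: divide_right_mono sum_mono)
      also have "\<dots> = green v"
        using N k Nil by (simp add: sum_green green_Nil field_simps)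
      finally show ?thesis .
    next
      case (snoc u b)
      then have u: "u \<in> states" and c: "0 \<le> real N - real k - 1 - real (length u)"
        using Suc.prems by (auto simp: states_def)
      show ?thesis
      proof (cases b)
        case True
        then have v: "v = u @ [True]"
          using snoc by simp
        have "S (Suc n) v = (\<Sum>w | w \<in> states \<and> strict_prefix u w. S n w) / real N"
          unfolding S_Suc using Suc.prems v
          by (simp add: start to_True S_def sum_divide_distrib[symmetric] sum.swap[of _ "{..<n}"])
        also have "\<dots> \<le> (\<Sum>w | w \<in> states \<and> strict_prefix u w. green w) / real N"
          using Suc.IH N by (intro divide_right_mono sum_mono) auto
        also have "\<dots> = green v"
          by (simp add: sum_green_extensions[OF u] green_snoc v)
        finally show ?thesis .
      next
        case False
        then have v: "v = u @ [False]"
          using snoc by simp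
        have "S (Suc n) v = S n u * ((real N - real k - 1 - real (length u)) / real N)"
          unfolding S_Suc using Suc.prems v
          by (simp add: start to_False S_def sum_divide_distrib[symmetric] sum_distrib_right[symmetric])
        also have "\<dots> \<le> green u * ((real N - real k - 1 - real (length u)) / real N)"
          using Suc.IH[OF u] c by (intro mult_right_mono) auto
        also have "\<dots> = green v"
          by (simp add: green_snoc v)
        finally show ?thesis .
      qed
    qed
  qed
  have ratio: "norm (1 - real k / real N) < 1"
    using k_less k N by (auto simp: abs_if field_simps)
  have "(\<lambda>n. (1 - real k / real N) ^ n) sums (real N / real k)"
    using geometric_sums[OF ratio] by simp
  then have "(\<lambda>n. real N / real k - (\<Sum>i<n. (1 - real k / real N) ^ i)) \<longlonglongrightarrow> real N / real k - real N / real k"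
    unfolding sums_def by (intro tendsto_diff tendsto_const)
  then have gap0: "(\<lambda>n. real N / real k - (\<Sum>i<n. (1 - real k / real N) ^ i)) \<longlonglongrightarrow> 0"
    by simp
  \<comment> \<open>All deficits are nonnegative, so each of them is at most the total deficit.\<close>
  have gap: "green w - S n w \<le> real N / real k - (\<Sum>i<n. (1 - real k / real N) ^ i)" for n
  proof -
    have "green w - S n w \<le> (\<Sum>v\<in>states. green v - S n v)"
      using w upper by (intro member_le_sum) auto
    also have "(\<Sum>v\<in>states. S n v) = (\<Sum>i<n. (1 - real k / real N) ^ i)"
      unfolding S_def by (subst sum.swap) (simp add: mass)
    then have "(\<Sum>v\<in>states. green v - S n v) = real N / real k - (\<Sum>i<n. (1 - real k / real N) ^ i)"
      by (simp add: sum_subtractf sum_green)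
    finally show ?thesis .
  qed
  have "(\<lambda>n. green w - S n w) \<longlonglongrightarrow> 0"
    by (rule tendsto_sandwich[OF _ _ tendsto_const gap0]) (use upper[OF w] gap in auto)
  then have "(\<lambda>n. green w - (green w - S n w)) \<longlonglongrightarrow> green w - 0"
    by (intro tendsto_diff tendsto_const)
  then show ?thesis
    by (simp add: sums_def S_def)
qed

end

section \<open>Finite histories of the uniform walk\<close>

text \<open>
  Events of the first \<open>n + 1\<close> coordinates, as predicates on whole sequences.
\<close>

definition determined :: "nat \<Rightarrow> ((nat \<Rightarrow> 'a) \<Rightarrow> bool) \<Rightarrow> bool" where
  "determined n Q \<longleftrightarrow> (\<forall>x y. (\<forall>i\<le>n. x i = y i) \<longrightarrow> Q x = Q y)"

lemma determinedI: "(\<And>x y. (\<forall>i\<le>n. x i = y i) \<Longrightarrow> Q x = Q y) \<Longrightarrow> determined n Q"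
  by (auto simp: determined_def)

lemma determinedD: "determined n Q \<Longrightarrow> (\<And>i. i \<le> n \<Longrightarrow> x i = y i) \<Longrightarrow> Q x = Q y"
  by (auto simp: determined_def)

context walk_parameters
begin

definition admissible :: "(nat \<Rightarrow> nat) \<Rightarrow> bool" where
  "admissible x \<longleftrightarrow> x 0 = N \<and> (\<forall>i. x i \<in> {1..N})"

text \<open>
  A history up to time \<open>n\<close> is encoded as an admissible sequence with the default value \<open>N\<close> after time \<open>n\<close>,
  so that predicates on sequences apply to histories as well.
\<close>

definition histories :: "nat \<Rightarrow> (nat \<Rightarrow> nat) set" where
  "histories n = {h. admissible h \<and> (\<forall>i>n. h i = N)}"

lemma histories_0: "histories 0 = {\<lambda>_. N}"
proof -
  have "h = (\<lambda>_. N)" if "h \<in> histories 0" for h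
  proof
    fix i show "h i = N"
      using that by (cases "i = 0") (simp_all add: histories_def admissible_def)
  qed
  moreover have "(\<lambda>_. N) \<in> histories 0"
    using k_less by (simp add: histories_def admissible_def)
  ultimately show ?thesis
    by blast
qed

lemma histories_Suc: "histories (Suc n) = (\<lambda>(h, a). h(Suc n := a)) ` (histories n \<times> {1..N})"
proof (intro equalityI subsetI)
  fix h assume h: "h \<in> histories (Suc n)"
  then have "h(Suc n := N) \<in> histories n" "h (Suc n) \<in> {1..N}"
    using k_less by (auto simp: histories_def admissible_def)
  moreover have "h = (h(Suc n := N))(Suc n := h (Suc n))"
    by simp
  ultimately show "h \<in> (\<lambda>(h, a). h(Suc n := a)) ` (histories n \<times> {1..N})"
    by (metis (no_types, lifting) SigmaI case_prod_conv image_eqI)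
qed (auto simp: histories_def admissible_def)

lemma inj_on_extend: "inj_on (\<lambda>(h, a). h(Suc n := a)) (histories n \<times> UNIV)"
proof (rule inj_onI, clarify)
  fix h a h' a'
  assume *: "h \<in> histories n" "h' \<in> histories n" "h(Suc n := a) = h'(Suc n := a')"
  have "h i = h' i" for i
    using *(1,2) fun_cong[OF *(3), of i] by (cases "i = Suc n") (auto simp: histories_def)
  then show "h = h' \<and> a = a'"
    using fun_cong[OF *(3), of "Suc n"] by auto
qed

lemma finite_histories [simp]: "finite (histories n)"
  by (induction n) (simp_all add: histories_0 histories_Suc)

lemma card_histories_step:
  assumes Q: "determined n Q" and R: "\<And>a. determined n (\<lambda>x. R x a)"
    and c: "\<And>x. admissible x \<Longrightarrow> Q x \<Longrightarrow> card {a \<in> {1..N}. R x a} = c"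
  shows "card {h \<in> histories (Suc n). Q h \<and> R h (h (Suc n))} = card {h \<in> histories n. Q h} * c"
proof -
  let ?S = "SIGMA h:{h \<in> histories n. Q h}. {a \<in> {1..N}. R h a}"
  have "Q (h(Suc n := a)) = Q h" "R (h(Suc n := a)) b = R h b" for h a b
    by (rule determinedD[OF Q] determinedD[OF R]; simp)+
  then have "{h \<in> histories (Suc n). Q h \<and> R h (h (Suc n))} = (\<lambda>(h, a). h(Suc n := a)) ` ?S"
    unfolding histories_Suc by auto
  moreover have "inj_on (\<lambda>(h, a). h(Suc n := a)) ?S"
    by (rule inj_on_subset[OF inj_on_extend]) auto
  ultimately have "card {h \<in> histories (Suc n). Q h \<and> R h (h (Suc n))} = card ?S"
    by (simp add: card_image)
  also have "\<dots> = (\<Sum>h | h \<in> histories n \<and> Q h. card {a \<in> {1..N}. R h a})"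
    by (subst card_SigmaI) auto
  also have "\<dots> = (\<Sum>h | h \<in> histories n \<and> Q h. c)"
    by (intro sum.cong refl c) (auto simp: histories_def)
  finally show ?thesis
    by simp
qed

end

locale uniform_walk = walk_parameters N k + prob_space M
  for N k and M :: "'a measure" +
  fixes X :: "nat \<Rightarrow> 'a \<Rightarrow> nat"
  assumes X_0: "\<omega> \<in> space M \<Longrightarrow> X 0 \<omega> = N"
    and X_indep: "indep_vars (\<lambda>_. count_space UNIV) X {1..}"
    and X_distr: "1 \<le> n \<Longrightarrow> distr M (count_space UNIV) (X n) = measure_pmf (pmf_of_set {1..N})"
begin

abbreviation traj :: "'a \<Rightarrow> nat \<Rightarrow> nat" where
  "traj \<omega> \<equiv> (\<lambda>n. X n \<omega>)"

lemma X_measurable [measurable]: "X n \<in> measurable M (count_space UNIV)"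
proof (cases "n = 0")
  case True
  have "(\<lambda>_. N) \<in> measurable M (count_space UNIV)"
    by simp
  then show ?thesis
    by (rule measurable_cong[THEN iffD1, rotated]) (simp add: True X_0)
next
  case False
  then show ?thesis
    using X_indep by (auto simp: indep_vars_def2)
qed

lemma measurable_determined:
  assumes "determined n Q"
  shows "{\<omega> \<in> space M. Q (traj \<omega>)} \<in> events"
proof -
  have hist: "(\<lambda>\<omega>. map (traj \<omega>) [0..<Suc n]) \<in> measurable M (count_space UNIV)"
  proof (rule measurable_count_space_eq2_countable[THEN iffD2], intro conjI ballI)
    fix l :: "nat list"
    have "(\<lambda>\<omega>. map (traj \<omega>) [0..<Suc n]) -` {l} \<inter> space M =
        {\<omega> \<in> space M. length l = Suc n \<and> (\<forall>i\<in>{..n}. X i \<omega> = l ! i)}"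
      by (auto simp: list_eq_iff_nth_eq less_Suc_eq_le simp del: upt_Suc)
    also have "\<dots> \<in> events"
      by measurable
    finally show "(\<lambda>\<omega>. map (traj \<omega>) [0..<Suc n]) -` {l} \<inter> space M \<in> events" .
  qed auto
  have "Q (traj \<omega>) \<longleftrightarrow> Q ((!) (map (traj \<omega>) [0..<Suc n]))" for \<omega>
    by (rule determinedD[OF assms]) (simp add: nth_map del: upt_Suc)
  then have "{\<omega> \<in> space M. Q (traj \<omega>)} =
      (\<lambda>\<omega>. map (traj \<omega>) [0..<Suc n]) -` {l. Q ((!) l)} \<inter> space M"
    by auto
  then show ?thesis
    using measurable_sets[OF hist, of "{l. Q ((!) l)}"] by simp
qed

lemma prob_X_eq:
  assumes "1 \<le> n" "a \<in> {1..N}"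
  shows "prob (X n -` {a} \<inter> space M) = 1 / real N"
proof -
  have "prob (X n -` {a} \<inter> space M) = measure (distr M (count_space UNIV) (X n)) {a}"
    by (simp add: measure_distr)
  also have "\<dots> = pmf (pmf_of_set {1..N}) a"
    by (simp add: X_distr[OF assms(1)] measure_pmf_single)
  also have "\<dots> = 1 / real N"
    using assms(2) by simp
  finally show ?thesis .
qed

lemma AE_admissible: "AE \<omega> in M. admissible (traj \<omega>)"
proof -
  have "AE \<omega> in M. X i \<omega> \<in> {1..N}" for i
  proof (cases "i = 0")
    case True
    then show ?thesis
      using k_less by (intro AE_I2) (auto simp: X_0)
  next
    case False
    have "AE a in measure_pmf (pmf_of_set {1..N}). a \<in> {1..N}"
      using k_less by (simp add: AE_measure_pmf_iff)
    then have "AE a in distr M (count_space UNIV) (X i). a \<in> {1..N}"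
      using False by (subst X_distr) simp_all
    then show ?thesis
      by (rule AE_distrD[OF X_measurable])
  qed
  then have "AE \<omega> in M. \<forall>i. X i \<omega> \<in> {1..N}"
    by (simp add: AE_all_countable)
  moreover have "AE \<omega> in M. X 0 \<omega> = N"
    by (intro AE_I2) (rule X_0)
  ultimately show ?thesis
    by eventually_elim (auto simp: admissible_def)
qed

lemma prob_history:
  assumes "h \<in> histories n"
  shows "prob {\<omega> \<in> space M. \<forall>i\<le>n. X i \<omega> = h i} = 1 / real N ^ n"
proof (cases "n = 0")
  case True
  then have "{\<omega> \<in> space M. \<forall>i\<le>n. X i \<omega> = h i} = space M"
    using assms X_0 by (auto simp: histories_def admissible_def)
  then show ?thesis
    using True by (simp add: prob_space)
next
  case False
  then have "{\<omega> \<in> space M. \<forall>i\<le>n. X i \<omega> = h i} = (\<Inter>i\<in>{1..n}. X i -` {h i} \<inter> space M)"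
  proof (intro equalityI subsetI)
    fix \<omega> assume *: "\<omega> \<in> (\<Inter>i\<in>{1..n}. X i -` {h i} \<inter> space M)"
    then have space: "\<omega> \<in> space M"
      using False by (auto dest: bspec[of _ _ 1])
    have "X i \<omega> = h i" if "i \<le> n" for i
      using * that assms X_0[OF space]
      by (cases "i = 0") (auto simp: histories_def admissible_def dest: bspec[of _ _ i])
    then show "\<omega> \<in> {\<omega> \<in> space M. \<forall>i\<le>n. X i \<omega> = h i}"
      using space by simp
  qed auto
  also have "prob \<dots> = (\<Prod>i\<in>{1..n}. prob (X i -` {h i} \<inter> space M))"
    using False by (intro indep_varsD[OF X_indep]) auto
  also have "\<dots> = (\<Prod>i\<in>{1..n}. 1 / real N)"
    using assms by (intro prod.cong refl prob_X_eq) (auto simp: histories_def admissible_def)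
  also have "\<dots> = 1 / real N ^ n"
    by (simp add: power_one_over)
  finally show ?thesis .
qed

text \<open>
  Almost every trajectory agrees up to time \<open>n\<close> with exactly one of the \<open>N ^ n\<close> equally likely
  histories.
\<close>

lemma prob_determined:
  assumes "determined n Q"
  shows "prob {\<omega> \<in> space M. Q (traj \<omega>)} = real (card {h \<in> histories n. Q h}) / real N ^ n"
proof -
  let ?C = "\<lambda>h. {\<omega> \<in> space M. \<forall>i\<le>n. X i \<omega> = h i}"
  let ?H = "{h \<in> histories n. Q h}"
  have C: "?C h \<in> events" for h
    by measurable
  have "AE \<omega> in M. \<omega> \<in> {\<omega> \<in> space M. Q (traj \<omega>)} \<longleftrightarrow> \<omega> \<in> (\<Union>h\<in>?H. ?C h)"
    using AE_admissible
  proof eventually_elim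
    fix \<omega> assume adm: "admissible (traj \<omega>)"
    define h where "h i = (if i \<le> n then X i \<omega> else N)" for i
    have "h \<in> histories n"
      using adm k_less by (auto simp: histories_def admissible_def h_def)
    moreover have "Q h = Q (traj \<omega>)"
      by (rule determinedD[OF assms]) (simp add: h_def)
    moreover have "Q h' = Q (traj \<omega>)" if "\<omega> \<in> ?C h'" for h'
      by (rule determinedD[OF assms]) (use that in auto)
    moreover have "\<omega> \<in> space M \<Longrightarrow> \<omega> \<in> ?C h"
      by (simp add: h_def)
    ultimately show "\<omega> \<in> {\<omega> \<in> space M. Q (traj \<omega>)} \<longleftrightarrow> \<omega> \<in> (\<Union>h\<in>?H. ?C h)"
      by blast
  qed
  then have "prob {\<omega> \<in> space M. Q (traj \<omega>)} = prob (\<Union>h\<in>?H. ?C h)"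
    using C measurable_determined[OF assms] by (intro measure_eq_AE) auto
  also have "\<dots> = (\<Sum>h\<in>?H. prob (?C h))"
  proof (rule finite_measure_finite_Union)
    show "disjoint_family_on ?C ?H"
      unfolding disjoint_family_on_def
    proof (intro ballI impI, rule ccontr)
      fix h h' assume *: "h \<in> ?H" "h' \<in> ?H" "h \<noteq> h'" "?C h \<inter> ?C h' \<noteq> {}"
      then obtain \<omega> where "\<forall>i\<le>n. X i \<omega> = h i" "\<forall>i\<le>n. X i \<omega> = h' i"
        by blast
      then have "\<forall>i\<le>n. h i = h' i"
        by simp
      moreover have "\<forall>i>n. h i = h' i"
        using * by (auto simp: histories_def)
      ultimately show False
        using *(3) by (metis ext not_le)
    qed
  qed (use C in auto)
  also have "\<dots> = (\<Sum>h\<in>?H. 1 / real N ^ n)"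
    by (intro sum.cong refl) (simp add: prob_history)
  finally show ?thesis
    by simp
qed

text \<open>
  The step at time \<open>n + 1\<close> is uniform and independent of the past. If the number \<open>c\<close> of favourable values
  does not depend on the past, counting histories gives the factor \<open>c/N\<close>. All transition
  probabilities below are instances.
\<close>

lemma prob_step:
  assumes Q: "determined n Q" and R: "\<And>a. determined n (\<lambda>x. R x a)"
    and c: "\<And>x. admissible x \<Longrightarrow> Q x \<Longrightarrow> card {a \<in> {1..N}. R x a} = c"
  shows "prob {\<omega> \<in> space M. Q (traj \<omega>) \<and> R (traj \<omega>) (X (Suc n) \<omega>)} =
    prob {\<omega> \<in> space M. Q (traj \<omega>)} * real c / real N"
proof -
  have "determined (Suc n) (\<lambda>x. Q x \<and> R x (x (Suc n)))"
  proof (rule determinedI)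
    fix x y :: "nat \<Rightarrow> nat" assume eq: "\<forall>i\<le>Suc n. x i = y i"
    have "Q x = Q y" "R x a = R y a" for a
      by (rule determinedD[OF Q] determinedD[OF R]; use eq in simp)+
    then show "(Q x \<and> R x (x (Suc n))) = (Q y \<and> R y (y (Suc n)))"
      using eq by simp
  qed
  from prob_determined[OF this] show ?thesis
    by (simp add: card_histories_step[OF assms] prob_determined[OF Q] mult.commute)
qed

end

section \<open>The law of the stopped walk\<close>

context walk_parameters
begin

lemma change_flags_in_states:
  assumes "admissible x" "avoids k x n"
  shows "change_flags x n \<in> states"
proof -
  have "set (lew x n) \<subseteq> {k<..N}"
    using set_lew_subset[of x n] avoids_lew[OF assms(2)] assms(1)
    by (fastforce simp: admissible_def)
  then have "card (set (lew x n)) \<le> N - k"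
    using card_mono[of "{k<..N}"] by simp
  then show ?thesis
    by (simp add: states_def distinct_card[OF lew_distinct] length_lew length_change_flags)
qed

text \<open>
  The vertices of a walk with \<open>l\<close> edges that avoids \<open>{1..k}\<close> are \<open>l + 1\<close> distinct elements of
  \<open>{k<..N}\<close>.
\<close>

lemma card_fresh_steps:
  assumes "admissible x" "avoids k x n" "length (change_flags x n) = l"
  shows "card {a \<in> {1..N}. a \<notin> set (lew x n) \<and> a \<notin> {1..k}} = N - k - 1 - l"
proof -
  have sub: "set (lew x n) \<subseteq> {k<..N}"
    using set_lew_subset[of x n] avoids_lew[OF assms(2)] assms(1)
    by (fastforce simp: admissible_def)
  have "{a \<in> {1..N}. a \<notin> set (lew x n) \<and> a \<notin> {1..k}} = {k<..N} - set (lew x n)"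
    by auto
  then have "card {a \<in> {1..N}. a \<notin> set (lew x n) \<and> a \<notin> {1..k}} = N - k - length (lew x n)"
    using sub by (simp add: card_Diff_subset distinct_card[OF lew_distinct])
  then show ?thesis
    using assms(3) by (simp add: length_lew length_change_flags)
qed

end

context uniform_walk
begin

text \<open>
  The defective law of the flags at time \<open>n\<close>: its mass is the probability that \<open>{1..k}\<close> has not been
  hit. It satisfies the hypotheses of \<open>sums_green\<close>.
\<close>

definition live_prob :: "nat \<Rightarrow> bool list \<Rightarrow> real" where
  "live_prob n w = prob {\<omega> \<in> space M. avoids k (traj \<omega>) n \<and> change_flags (traj \<omega>) n = w}"

lemma determined_live:
  "determined n (\<lambda>x. avoids k x n \<and> P (change_flags x n))"
  by (rule determinedI) (metis avoids_cong change_flags_cong)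

lemma determined_lew: "determined n (\<lambda>x. P (lew x n))"
  by (rule determinedI) (metis walk_cong)

lemma live_prob_nonneg: "0 \<le> live_prob n w"
  by (simp add: live_prob_def)

lemma sum_live_prob:
  "(\<Sum>w | w \<in> states \<and> P w. live_prob n w) =
     prob {\<omega> \<in> space M. avoids k (traj \<omega>) n \<and> P (change_flags (traj \<omega>) n)}"
proof -
  let ?W = "{w. w \<in> states \<and> P w}"
  let ?A = "\<lambda>w. {\<omega> \<in> space M. avoids k (traj \<omega>) n \<and> change_flags (traj \<omega>) n = w}"
  have A: "{\<omega> \<in> space M. avoids k (traj \<omega>) n \<and> Q (change_flags (traj \<omega>) n)} \<in> events" for Q
    by (rule measurable_determined[OF determined_live])
  have "(\<Sum>w\<in>?W. live_prob n w) = prob (\<Union>w\<in>?W. ?A w)"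
    unfolding live_prob_def
    by (rule finite_measure_finite_Union[symmetric])
      (use A[of "\<lambda>v. v = _"] in \<open>auto simp: disjoint_family_on_def\<close>)
  also have "\<dots> = prob {\<omega> \<in> space M. avoids k (traj \<omega>) n \<and> P (change_flags (traj \<omega>) n)}"
  proof (rule measure_eq_AE)
    show "AE \<omega> in M. \<omega> \<in> (\<Union>w\<in>?W. ?A w) \<longleftrightarrow>
        \<omega> \<in> {\<omega> \<in> space M. avoids k (traj \<omega>) n \<and> P (change_flags (traj \<omega>) n)}"
      using AE_admissible by eventually_elim (auto dest: change_flags_in_states)
    show "(\<Union>w\<in>?W. ?A w) \<in> events"
      using A[of "\<lambda>v. v = _"] by (intro sets.finite_UN) auto
  qed (rule A)
  finally show ?thesis .
qed

lemma prob_avoids: "prob {\<omega> \<in> space M. avoids k (traj \<omega>) n} = (1 - real k / real N) ^ n"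
proof (induction n)
  case 0
  have "{\<omega> \<in> space M. avoids k (traj \<omega>) 0} = space M"
    using k_less X_0 by (auto simp: avoids_def)
  then show ?case
    by (simp add: prob_space)
next
  case (Suc n)
  have "prob {\<omega> \<in> space M. avoids k (traj \<omega>) n \<and> X (Suc n) \<omega> \<notin> {1..k}} =
      prob {\<omega> \<in> space M. avoids k (traj \<omega>) n} * real (N - k) / real N"
  proof (rule prob_step)
    have "{a \<in> {1..N}. a \<notin> {1..k}} = {k<..N}"
      by auto
    then show "card {a \<in> {1..N}. a \<notin> {1..k}} = N - k"
      by simp
  qed (use determined_live[of n "\<lambda>_. True"] in \<open>simp_all add: determined_def\<close>)
  also have "real (N - k) = real N * (1 - real k / real N)"
    using k_less by (simp add: of_nat_diff right_diff_distrib)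
  also have "prob {\<omega> \<in> space M. avoids k (traj \<omega>) n} * (real N * (1 - real k / real N)) / real N =
      (1 - real k / real N) ^ Suc n"
    using k_less by (simp add: Suc.IH)
  finally show ?case
    by (simp add: avoids_Suc)
qed

lemma live_prob_0: "live_prob 0 w = (if w = [] then 1 else 0)"
proof -
  have "{\<omega> \<in> space M. avoids k (traj \<omega>) 0 \<and> change_flags (traj \<omega>) 0 = w} =
      (if w = [] then space M else {})"
    using k_less X_0 by (auto simp: avoids_def change_flags_0)
  then show ?thesis
    by (simp add: live_prob_def prob_space)
qed

lemma live_prob_Suc_Nil:
  "live_prob (Suc n) [] = (\<Sum>w\<in>states. live_prob n w) / real N"
proof -
  \<comment> \<open>The conjunct \<open>True\<close> brings the event into the form of \<open>determined_live\<close>, with no condition on the flags.\<close>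
  have "live_prob (Suc n) [] =
      prob {\<omega> \<in> space M. (avoids k (traj \<omega>) n \<and> True) \<and> X (Suc n) \<omega> = N}"
    unfolding live_prob_def
    by (rule arg_cong[where f = prob])
      (use k_less X_0 in \<open>auto simp: avoids_Suc change_flags_Suc_Nil\<close>)
  also have "\<dots> = prob {\<omega> \<in> space M. avoids k (traj \<omega>) n \<and> True} * real 1 / real N"
  proof (rule prob_step)
    have "{a \<in> {1..N}. a = N} = {N}"
      using k_less by auto
    then show "card {a \<in> {1..N}. a = N} = 1"
      by simp
  qed (rule determined_live, simp add: determined_def)
  also have "prob {\<omega> \<in> space M. avoids k (traj \<omega>) n \<and> True} = (\<Sum>w\<in>states. live_prob n w)"
    using sum_live_prob[of n "\<lambda>_. True"] by simp
  finally show ?thesis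
    by simp
qed

lemma live_prob_Suc_False:
  assumes "u @ [False] \<in> states"
  shows "live_prob (Suc n) (u @ [False]) =
    live_prob n u * (real N - real k - 1 - real (length u)) / real N"
proof -
  have "live_prob (Suc n) (u @ [False]) =
      prob {\<omega> \<in> space M. (avoids k (traj \<omega>) n \<and> change_flags (traj \<omega>) n = u) \<and>
        X (Suc n) \<omega> \<notin> set (lew (traj \<omega>) n) \<and> X (Suc n) \<omega> \<notin> {1..k}}"
    unfolding live_prob_def
    by (rule arg_cong[where f = prob]) (auto simp: avoids_Suc change_flags_Suc_False)
  also have "\<dots> = prob {\<omega> \<in> space M. avoids k (traj \<omega>) n \<and> change_flags (traj \<omega>) n = u} *
      real (N - k - 1 - length u) / real N"
    by (rule prob_step[OF determined_live determined_lew]) (rule card_fresh_steps, auto)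
  also have "real (N - k - 1 - length u) = real N - real k - 1 - real (length u)"
    using assms by (simp add: states_def of_nat_diff)
  finally show ?thesis
    by (simp add: live_prob_def)
qed

lemma live_prob_Suc_True:
  "live_prob (Suc n) (u @ [True]) =
    (\<Sum>w | w \<in> states \<and> strict_prefix u w. live_prob n w) / real N"
proof -
  have mem: "lew x n ! Suc (length u) \<in> set (lew x n)" if "strict_prefix u (change_flags x n)"
    for x :: "nat \<Rightarrow> nat"
    using prefix_length_less[OF that] by (simp add: length_lew length_change_flags)
  have "live_prob (Suc n) (u @ [True]) =
      prob {\<omega> \<in> space M. (avoids k (traj \<omega>) n \<and> strict_prefix u (change_flags (traj \<omega>) n)) \<and>
        X (Suc n) \<omega> = lew (traj \<omega>) n ! Suc (length u)}"
    unfolding live_prob_def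
  proof (rule arg_cong[where f = prob], rule Collect_cong, rule conj_cong[OF refl])
    fix \<omega>
    show "(avoids k (traj \<omega>) (Suc n) \<and> change_flags (traj \<omega>) (Suc n) = u @ [True]) \<longleftrightarrow>
        ((avoids k (traj \<omega>) n \<and> strict_prefix u (change_flags (traj \<omega>) n)) \<and>
        X (Suc n) \<omega> = lew (traj \<omega>) n ! Suc (length u))"
      using mem[of "traj \<omega>"] avoids_lew[of k "traj \<omega>" n]
      unfolding avoids_Suc change_flags_Suc_True by (metis disjoint_iff)
  qed
  also have "\<dots> = prob {\<omega> \<in> space M. avoids k (traj \<omega>) n \<and>
      strict_prefix u (change_flags (traj \<omega>) n)} * real 1 / real N"
  proof (rule prob_step[OF determined_live determined_lew])
    fix x assume x: "admissible x" "avoids k x n \<and> strict_prefix u (change_flags x n)"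
    have "lew x n ! Suc (length u) \<in> {1..N}"
      using mem[of x] x set_lew_subset[of x n] by (auto simp: admissible_def)
    then have "{a \<in> {1..N}. a = lew x n ! Suc (length u)} = {lew x n ! Suc (length u)}"
      by auto
    then show "card {a \<in> {1..N}. a = lew x n ! Suc (length u)} = 1"
      by simp
  qed
  finally show ?thesis
    by (simp add: sum_live_prob)
qed

lemma live_prob_sums_green:
  assumes "w \<in> states"
  shows "(\<lambda>n. live_prob n w) sums green w"
proof (rule sums_green[OF live_prob_nonneg live_prob_0 live_prob_Suc_Nil live_prob_Suc_False
      live_prob_Suc_True _ assms])
  show "(\<Sum>w\<in>states. live_prob n w) = (1 - real k / real N) ^ n" for n
    using sum_live_prob[of n "\<lambda>_. True"] prob_avoids[of n] by simp
qed

lemma X_in_measurable [measurable]: "Measurable.pred M (\<lambda>\<omega>. X n \<omega> \<in> A)"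
  by (rule measurable_compose[OF X_measurable]) simp

definition stops_with :: "bool list \<Rightarrow> nat \<Rightarrow> 'a set" where
  "stops_with w n = {\<omega> \<in> space M.
     (avoids k (traj \<omega>) n \<and> change_flags (traj \<omega>) n = w) \<and> X (Suc n) \<omega> \<in> {1..k}}"

lemma stops_with_sets: "stops_with w n \<in> events"
proof -
  have "{\<omega> \<in> space M. avoids k (traj \<omega>) n \<and> change_flags (traj \<omega>) n = w} \<in> events"
    by (rule measurable_determined[OF determined_live])
  moreover have "{\<omega> \<in> space M. X (Suc n) \<omega> \<in> {1..k}} \<in> events"
    by measurable
  moreover have "stops_with w n =
      {\<omega> \<in> space M. avoids k (traj \<omega>) n \<and> change_flags (traj \<omega>) n = w} \<inter>
      {\<omega> \<in> space M. X (Suc n) \<omega> \<in> {1..k}}"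
    by (auto simp: stops_with_def)
  ultimately show ?thesis
    by simp
qed

lemma prob_stops_with: "prob (stops_with w n) = live_prob n w * real k / real N"
  unfolding stops_with_def live_prob_def
proof (rule prob_step[OF determined_live])
  have "{a \<in> {1..N}. a \<in> {1..k}} = {1..k}"
    using k_less by auto
  then show "card {a \<in> {1..N}. a \<in> {1..k}} = k"
    by simp
qed (simp add: determined_def)

lemma stops_with_unique:
  assumes "\<omega> \<in> stops_with w n" "\<omega> \<in> stops_with w' n'"
  shows "n = n'" "w = w'"
proof -
  have "hitting_time k (traj \<omega>) = Suc n" "hitting_time k (traj \<omega>) = Suc n'"
    using assms by (auto simp: stops_with_def intro: hitting_time_eq)
  then show "n = n'"
    by simp
  then show "w = w'"
    using assms by (simp add: stops_with_def)
qed

lemma stop_sets: "(\<Union>n. stops_with w n) \<in> events"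
  using stops_with_sets by auto

lemma disjoint_stop: "disjoint_family_on (\<lambda>w. \<Union>n. stops_with w n) W"
  unfolding disjoint_family_on_def by (blast dest: stops_with_unique(2))

text \<open>
  The stopping times \<open>n + 1\<close> are mutually exclusive, and each visit to \<open>w\<close> is followed by a stop with
  probability \<open>k/N\<close>; so the probabilities add up to \<open>green w \<cdot> k/N\<close>.
\<close>

lemma prob_stop:
  assumes "w \<in> states"
  shows "prob (\<Union>n. stops_with w n) =
    stop_weight (Suc (length w)) * (\<Prod>i<length w. flag_weight i (w ! i))"
proof -
  have "(\<lambda>n. prob (stops_with w n)) sums prob (\<Union>n. stops_with w n)"
    using stops_with_sets
    by (intro finite_measure_UNION) (auto simp: disjoint_family_on_def dest: stops_with_unique)
  moreover have "(\<lambda>n. live_prob n w * (real k / real N)) sums (green w * (real k / real N))"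
    by (intro sums_mult2 live_prob_sums_green assms)
  ultimately have "prob (\<Union>n. stops_with w n) = green w * (real k / real N)"
    by (intro sums_unique2) (simp_all add: prob_stops_with)
  then show ?thesis
    using k_pos k_less by (simp add: green_def)
qed

text \<open>
  The stopping probabilities of all lists add up to one. In particular \<open>{1..k}\<close> is hit almost surely.
\<close>

lemma AE_stops:
  "AE \<omega> in M. \<exists>w\<in>states. \<exists>n. \<omega> \<in> stops_with w n"
proof -
  have "prob (\<Union>w\<in>states. \<Union>n. stops_with w n) = (\<Sum>w\<in>states. prob (\<Union>n. stops_with w n))"
    by (rule finite_measure_finite_Union[OF _ _ disjoint_stop]) (use stop_sets finite_states in \<open>auto simp del: UN_iff\<close>)
  also have "\<dots> = (\<Sum>w\<in>states. green w) * (real k / real N)"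
    unfolding sum_distrib_right
    using k_pos k_less by (intro sum.cong refl) (simp add: prob_stop green_def)
  also have "\<dots> = 1"
    using k_pos k_less by (simp add: sum_green)
  finally have "AE \<omega> in M. \<omega> \<in> (\<Union>w\<in>states. \<Union>n. stops_with w n)"
    using stop_sets by (intro prob_eq_1[THEN iffD1]) auto
  then show ?thesis
    by simp
qed

lemma prob_eq_sum_stop:
  assumes A: "A \<in> events"
    and P: "\<And>w n \<omega>. w \<in> states \<Longrightarrow> \<omega> \<in> stops_with w n \<Longrightarrow> \<omega> \<in> A \<longleftrightarrow> P w"
  shows "prob A = (\<Sum>w | w \<in> states \<and> P w.
    stop_weight (Suc (length w)) * (\<Prod>i<length w. flag_weight i (w ! i)))"
proof -
  let ?W = "{w. w \<in> states \<and> P w}"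
  have sets: "(\<Union>n. stops_with w n) \<in> events" for w
    using stops_with_sets by auto
  have "prob A = prob (\<Union>w\<in>?W. \<Union>n. stops_with w n)"
  proof (rule measure_eq_AE[OF _ A])
    show "AE \<omega> in M. \<omega> \<in> A \<longleftrightarrow> \<omega> \<in> (\<Union>w\<in>?W. \<Union>n. stops_with w n)"
      using AE_stops by eventually_elim (use P in blast)
    show "(\<Union>w\<in>?W. \<Union>n. stops_with w n) \<in> events"
      by (rule sets.finite_UN) (simp_all add: stop_sets)
  qed
  also have "\<dots> = (\<Sum>w\<in>?W. prob (\<Union>n. stops_with w n))"
    by (rule finite_measure_finite_Union[OF _ _ disjoint_stop]) (use stop_sets finite_states in \<open>auto simp del: UN_iff\<close>)
  finally show ?thesis
    by (simp add: prob_stop)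
qed

lemma hitting_time_measurable:
  "{\<omega> \<in> space M. hitting_time k (traj \<omega>) = n} \<in> events"
proof -
  have [measurable]: "(\<lambda>\<omega>. hitting_time k (traj \<omega>)) \<in> measurable M (count_space UNIV)"
    unfolding hitting_time_def by measurable
  show ?thesis
    by measurable
qed

text \<open>
  A property of the sequence at its random hitting time is a countable union over the values of
  that time.
\<close>

lemma hitting_time_section:
  assumes "\<And>n. determined n (Q n)"
  shows "{\<omega> \<in> space M. Q (hitting_time k (traj \<omega>)) (traj \<omega>)} \<in> events"
proof -
  have "{\<omega> \<in> space M. Q (hitting_time k (traj \<omega>)) (traj \<omega>)} =
      (\<Union>n. {\<omega> \<in> space M. hitting_time k (traj \<omega>) = n} \<inter> {\<omega> \<in> space M. Q n (traj \<omega>)})"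
    by auto
  then show ?thesis
    using hitting_time_measurable measurable_determined[OF assms] by auto
qed

lemma stopped_length_sets: "{\<omega> \<in> space M. stopped_length k (traj \<omega>) = j} \<in> events"
  unfolding stopped_length_def
proof (rule hitting_time_section)
  show "determined n (\<lambda>x. lew_length x n = j)" for n
    unfolding lew_length_def by (rule determined_lew)
qed

lemma colour_change_sets: "{\<omega> \<in> space M. colour_change k (traj \<omega>) i} \<in> events"
  unfolding colour_change_def stopped_length_def
proof (rule hitting_time_section)
  show "determined n (\<lambda>x. 1 \<le> i \<and> i + 1 \<le> lew_length x n \<and>
      edge_colours x n ! (i - 1) \<noteq> edge_colours x n ! i)" for n
    by (rule determinedI) (metis lew_length_def walk_cong)
qed

text \<open>
  Summing the product weights over the lists of length \<open>j - 1\<close> whose flags in \<open>J\<close> are set: the free flags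
  contribute a factor \<open>1\<close>, the flags in \<open>J\<close> their probability of being set.
\<close>

lemma prob_length_and_changes:
  assumes J: "J \<subseteq> {1..j - 1}"
  shows "prob {\<omega> \<in> space M. stopped_length k (traj \<omega>) = j \<and> (\<forall>i\<in>J. colour_change k (traj \<omega>) i)} =
    (if j \<in> {1..N - k} then stop_weight j * (\<Prod>i\<in>J. 1 / real (k + i + 1)) else 0)"
proof -
  have fin: "finite J"
    using J finite_subset by blast
  let ?A = "{\<omega> \<in> space M. stopped_length k (traj \<omega>) = j \<and> (\<forall>i\<in>J. colour_change k (traj \<omega>) i)}"
  have "?A = {\<omega> \<in> space M. stopped_length k (traj \<omega>) = j} \<inter>
      {\<omega> \<in> space M. \<forall>i\<in>J. colour_change k (traj \<omega>) i}"
    by auto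
  moreover have "{\<omega> \<in> space M. \<forall>i\<in>J. colour_change k (traj \<omega>) i} \<in> events"
    using fin colour_change_sets by (intro sets.sets_Collect_finite_All) auto
  ultimately have A: "?A \<in> events"
    using stopped_length_sets by simp
  have "prob ?A = (\<Sum>w | w \<in> states \<and> (Suc (length w) = j \<and> (\<forall>i\<in>J. w ! (i - 1))).
      stop_weight (Suc (length w)) * (\<Prod>i<length w. flag_weight i (w ! i)))"
  proof (rule prob_eq_sum_stop[OF A])
    fix w n \<omega> assume "\<omega> \<in> stops_with w n"
    then have \<omega>: "\<omega> \<in> space M" "avoids k (traj \<omega>) n" "change_flags (traj \<omega>) n = w"
      "traj \<omega> (Suc n) \<in> {1..k}"
      by (auto simp: stops_with_def)
    show "\<omega> \<in> ?A \<longleftrightarrow> Suc (length w) = j \<and> (\<forall>i\<in>J. w ! (i - 1))"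
      using J \<omega>(1) stopped_length_eq[OF \<omega>(2,4)] colour_change_eq[OF \<omega>(2,4)]
      unfolding \<omega>(3) by (auto simp: subset_iff)
  qed
  also have "\<dots> = (if j \<in> {1..N - k} then stop_weight j * (\<Prod>i\<in>J. 1 / real (k + i + 1)) else 0)"
  proof (cases "j \<in> {1..N - k}")
    case False
    then have none: "{w. w \<in> states \<and> (Suc (length w) = j \<and> (\<forall>i\<in>J. w ! (i - 1)))} = {}"
      by (auto simp: states_def)
    show ?thesis
      unfolding none if_not_P[OF False] by simp
  next
    case True
    \<comment> \<open>Condition \<open>J\<close> is absorbed into the weights by giving weight \<open>0\<close> to an unset flag in \<open>J\<close> (edge \<open>Suc i\<close> has list index \<open>i\<close>).\<close>
    define \<phi> where "\<phi> i b = (if Suc i \<in> J \<and> \<not> b then 0 else flag_weight i b)" for i b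
    let ?L = "{w :: bool list. length w = j - 1}"
    have W: "{w. w \<in> states \<and> (Suc (length w) = j \<and> (\<forall>i\<in>J. w ! (i - 1)))} =
        {w \<in> ?L. \<forall>i\<in>J. w ! (i - 1)}"
      using True by (auto simp: states_def)
    have prod: "(\<Prod>i<j - 1. \<phi> i (w ! i)) =
        (if \<forall>i\<in>J. w ! (i - 1) then \<Prod>i<j - 1. flag_weight i (w ! i) else 0)" for w
    proof (cases "\<forall>i\<in>J. w ! (i - 1)")
      case True
      then have "\<phi> i (w ! i) = flag_weight i (w ! i)" for i
        by (force simp: \<phi>_def)
      then show ?thesis
        using True by simp
    next
      case False
      then obtain i where "i \<in> J" "\<not> w ! (i - 1)"
        by blast
      then have "i - 1 < j - 1" "\<phi> (i - 1) (w ! (i - 1)) = 0"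
        using J by (auto simp: \<phi>_def subset_iff)
      then have "(\<Prod>i<j - 1. \<phi> i (w ! i)) = 0"
        by (intro prod_zero) auto
      then show ?thesis
        unfolding if_not_P[OF False] .
    qed
    have "(\<Sum>w\<in>{w \<in> ?L. \<forall>i\<in>J. w ! (i - 1)}.
        stop_weight (Suc (length w)) * (\<Prod>i<length w. flag_weight i (w ! i))) =
        (\<Sum>w\<in>{w \<in> ?L. \<forall>i\<in>J. w ! (i - 1)}. stop_weight j * (\<Prod>i<j - 1. flag_weight i (w ! i)))"
      using True by (intro sum.cong refl) auto
    also have "\<dots> = (\<Sum>w\<in>?L. if \<forall>i\<in>J. w ! (i - 1)
        then stop_weight j * (\<Prod>i<j - 1. flag_weight i (w ! i)) else 0)"
      by (intro sum.inter_filter) simp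
    also have "\<dots> = stop_weight j * (\<Sum>w\<in>?L. \<Prod>i<j - 1. \<phi> i (w ! i))"
      unfolding sum_distrib_left prod by (intro sum.cong refl) auto
    also have "(\<Sum>w\<in>?L. \<Prod>i<j - 1. \<phi> i (w ! i)) = (\<Prod>i<j - 1. \<phi> i True + \<phi> i False)"
      by (rule sum_bool_lists_prod)
    also have "\<dots> = (\<Prod>i<j - 1. if Suc i \<in> J then 1 / real (k + Suc i + 1) else 1)"
      using flag_weight_add by (intro prod.cong refl) (auto simp: \<phi>_def flag_weight_def)
    also have "\<dots> = (\<Prod>i\<in>{1..j - 1}. if i \<in> J then 1 / real (k + i + 1) else 1)"
      by (rule prod.reindex_bij_witness[of _ "\<lambda>i. i - 1" Suc]) auto
    also have "\<dots> = (\<Prod>i\<in>{1..j - 1} \<inter> J. 1 / real (k + i + 1))"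
      by (rule prod.inter_restrict[symmetric]) simp
    also have "{1..j - 1} \<inter> J = J"
      using J by blast
    finally show ?thesis
      unfolding W using True by simp
  qed
  finally show ?thesis .
qed

end

section \<open>The first repeat time\<close>

lemma inj_on_atMost_iff_no_repeat:
  "inj_on x {..n} \<longleftrightarrow> (\<forall>i\<le>n. \<not> (1 \<le> i \<and> x i \<in> x ` {..<i}))" for x :: "nat \<Rightarrow> 'a"
proof
  assume inj: "inj_on x {..n}"
  show "\<forall>i\<le>n. \<not> (1 \<le> i \<and> x i \<in> x ` {..<i})"
  proof (intro allI impI notI, elim conjE imageE)
    fix i j assume *: "i \<le> n" "x i = x j" "j \<in> {..<i}"
    then show False
      using inj_onD[OF inj *(2)] by simp
  qed
next
  assume *: "\<forall>i\<le>n. \<not> (1 \<le> i \<and> x i \<in> x ` {..<i})"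
  have "x i \<noteq> x j" if "i \<le> n" "j < i" for i j
    using * that by (metis Suc_leI gr_implies_not0 imageI lessThan_iff not_gr_zero One_nat_def)
  then show "inj_on x {..n}"
    by (intro inj_onI) (metis atMost_iff linorder_neqE_nat)
qed

lemma inj_on_atMost_Suc: "inj_on x {..Suc n} \<longleftrightarrow> inj_on x {..n} \<and> x (Suc n) \<notin> x ` {..n}"
  by (auto simp: atMost_Suc)

context walk_parameters
begin

lemma not_inj_on_atMost_N:
  assumes "admissible x"
  shows "\<not> inj_on x {..N}"
proof
  assume "inj_on x {..N}"
  then have "card {..N} \<le> card {1..N}"
    using assms by (intro card_inj_on_le) (auto simp: admissible_def)
  then show False
    by simp
qed

text \<open>
  By the pigeonhole principle an admissible sequence repeats a value by time \<open>N\<close>, so the minimum that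
  defines \<open>first_repeat\<close> is attained.
\<close>

lemma first_repeat_gt_iff:
  assumes "admissible x"
  shows "n < first_repeat x \<longleftrightarrow> inj_on x {..n}"
proof -
  obtain i where "1 \<le> i \<and> x i \<in> x ` {..<i}"
    using not_inj_on_atMost_N[OF assms] unfolding inj_on_atMost_iff_no_repeat by blast
  then have least: "1 \<le> first_repeat x \<and> x (first_repeat x) \<in> x ` {..<first_repeat x}"
    unfolding first_repeat_def by (rule LeastI)
  have "n < first_repeat x \<longleftrightarrow> (\<forall>i\<le>n. \<not> (1 \<le> i \<and> x i \<in> x ` {..<i}))"
  proof
    assume "n < first_repeat x"
    then show "\<forall>i\<le>n. \<not> (1 \<le> i \<and> x i \<in> x ` {..<i})"
      unfolding first_repeat_def by (metis le_less_trans not_less_Least)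
  next
    assume "\<forall>i\<le>n. \<not> (1 \<le> i \<and> x i \<in> x ` {..<i})"
    then show "n < first_repeat x"
      using least not_le by blast
  qed
  then show ?thesis
    by (simp only: inj_on_atMost_iff_no_repeat)
qed

lemma first_repeat_eq_Suc_iff:
  assumes "admissible x"
  shows "first_repeat x = Suc n \<longleftrightarrow> inj_on x {..n} \<and> x (Suc n) \<in> x ` {..n}"
proof -
  have "first_repeat x = Suc n \<longleftrightarrow> n < first_repeat x \<and> \<not> Suc n < first_repeat x"
    by auto
  then show ?thesis
    by (auto simp: first_repeat_gt_iff[OF assms] inj_on_atMost_Suc)
qed

end

context uniform_walk
begin

lemma determined_inj_on: "determined n (\<lambda>x. inj_on x {..n})"
  by (rule determinedI, rule inj_on_cong) simp

lemma determined_image: "determined n (\<lambda>x. P (x ` {..n}))"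
  by (rule determinedI, rule arg_cong[where f = P], rule image_cong) simp_all

lemma prob_inj_on:
  "n < N \<Longrightarrow> prob {\<omega> \<in> space M. inj_on (traj \<omega>) {..n}} =
     falling_factorial (real N - 1) n / real N ^ n"
proof (induction n)
  case 0
  then show ?case
    by (simp add: prob_space falling_factorial_def)
next
  case (Suc n)
  have "prob {\<omega> \<in> space M. inj_on (traj \<omega>) {..n} \<and> X (Suc n) \<omega> \<notin> traj \<omega> ` {..n}} =
      prob {\<omega> \<in> space M. inj_on (traj \<omega>) {..n}} * real (N - Suc n) / real N"
  proof (rule prob_step[OF determined_inj_on determined_image])
    fix x assume x: "admissible x" "inj_on x {..n}"
    have "{a \<in> {1..N}. a \<notin> x ` {..n}} = {1..N} - x ` {..n}"
      by auto
    moreover have "x ` {..n} \<subseteq> {1..N}"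
      using x by (auto simp: admissible_def)
    ultimately show "card {a \<in> {1..N}. a \<notin> x ` {..n}} = N - Suc n"
      using x(2) by (simp add: card_Diff_subset card_image)
  qed
  then show ?case
    using Suc by (simp add: inj_on_atMost_Suc falling_factorial_Suc of_nat_diff)
      (simp add: mult_ac)
qed

lemma first_repeat_measurable [measurable]:
  "(\<lambda>\<omega>. first_repeat (traj \<omega>)) \<in> measurable M (count_space UNIV)"
  unfolding first_repeat_def
proof (rule measurable_Least)
  fix i
  have "determined i (\<lambda>x :: nat \<Rightarrow> nat. i \<ge> 1 \<and> x i \<in> x ` {..<i})"
  proof (rule determinedI)
    fix x y :: "nat \<Rightarrow> nat" assume "\<forall>j\<le>i. x j = y j"
    then have "x i = y i" "x ` {..<i} = y ` {..<i}"
      by (auto intro: image_cong)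
    then show "(i \<ge> 1 \<and> x i \<in> x ` {..<i}) = (i \<ge> 1 \<and> y i \<in> y ` {..<i})"
      by simp
  qed
  from measurable_determined[OF this]
  show "Measurable.pred M (\<lambda>\<omega>. i \<ge> 1 \<and> X i \<omega> \<in> traj \<omega> ` {..<i})"
    by (simp only: pred_def)
qed

lemma prob_first_repeat_gt:
  assumes "n < N"
  shows "prob {\<omega> \<in> space M. n < first_repeat (traj \<omega>)} = falling_factorial (real N - 1) n / real N ^ n"
proof -
  have "prob {\<omega> \<in> space M. n < first_repeat (traj \<omega>)} = prob {\<omega> \<in> space M. inj_on (traj \<omega>) {..n}}"
  proof (rule measure_eq_AE)
    show "AE \<omega> in M. \<omega> \<in> {\<omega> \<in> space M. n < first_repeat (traj \<omega>)} \<longleftrightarrow>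
        \<omega> \<in> {\<omega> \<in> space M. inj_on (traj \<omega>) {..n}}"
      using AE_admissible by eventually_elim (simp add: first_repeat_gt_iff)
    show "{\<omega> \<in> space M. n < first_repeat (traj \<omega>)} \<in> events"
      by measurable
  qed (rule measurable_determined[OF determined_inj_on])
  then show ?thesis
    using prob_inj_on[OF assms] by simp
qed

lemma prob_first_repeat_eq_Suc:
  assumes "n < N"
  shows "prob {\<omega> \<in> space M. first_repeat (traj \<omega>) = Suc n} =
    real (Suc n) * falling_factorial (real N - 1) n / real N ^ Suc n"
proof -
  have "prob {\<omega> \<in> space M. inj_on (traj \<omega>) {..n} \<and> X (Suc n) \<omega> \<in> traj \<omega> ` {..n}} =
      prob {\<omega> \<in> space M. inj_on (traj \<omega>) {..n}} * real (Suc n) / real N"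
  proof (rule prob_step[OF determined_inj_on determined_image])
    fix x assume x: "admissible x" "inj_on x {..n}"
    have "{a \<in> {1..N}. a \<in> x ` {..n}} = x ` {..n}"
      using x by (auto simp: admissible_def)
    then show "card {a \<in> {1..N}. a \<in> x ` {..n}} = Suc n"
      using x(2) by (simp add: card_image)
  qed
  also have "\<dots> = real (Suc n) * falling_factorial (real N - 1) n / real N ^ Suc n"
    by (simp add: prob_inj_on[OF assms] mult_ac)
  finally have eq: "prob {\<omega> \<in> space M. inj_on (traj \<omega>) {..n} \<and> X (Suc n) \<omega> \<in> traj \<omega> ` {..n}} =
      real (Suc n) * falling_factorial (real N - 1) n / real N ^ Suc n" .
  have "determined (Suc n) (\<lambda>x :: nat \<Rightarrow> nat. inj_on x {..n} \<and> x (Suc n) \<in> x ` {..n})"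
  proof (rule determinedI)
    fix x y :: "nat \<Rightarrow> nat" assume eq: "\<forall>i\<le>Suc n. x i = y i"
    have "inj_on x {..n} = inj_on y {..n}" "x ` {..n} = y ` {..n}"
      by (rule inj_on_cong image_cong; use eq in simp)+
    moreover have "x (Suc n) = y (Suc n)"
      using eq by simp
    ultimately show "(inj_on x {..n} \<and> x (Suc n) \<in> x ` {..n}) = (inj_on y {..n} \<and> y (Suc n) \<in> y ` {..n})"
      by simp
  qed
  note sets = measurable_determined[OF this]
  have "prob {\<omega> \<in> space M. first_repeat (traj \<omega>) = Suc n} =
      prob {\<omega> \<in> space M. inj_on (traj \<omega>) {..n} \<and> X (Suc n) \<omega> \<in> traj \<omega> ` {..n}}"
  proof (rule measure_eq_AE[OF _ _ sets])
    show "AE \<omega> in M. \<omega> \<in> {\<omega> \<in> space M. first_repeat (traj \<omega>) = Suc n} \<longleftrightarrow>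
        \<omega> \<in> {\<omega> \<in> space M. inj_on (traj \<omega>) {..n} \<and> X (Suc n) \<omega> \<in> traj \<omega> ` {..n}}"
      using AE_admissible by eventually_elim (simp add: first_repeat_eq_Suc_iff)
    show "{\<omega> \<in> space M. first_repeat (traj \<omega>) = Suc n} \<in> events"
      by measurable
  qed
  then show ?thesis
    using eq by simp
qed

lemma prob_first_repeat_gt_pos: "prob {\<omega> \<in> space M. k < first_repeat (traj \<omega>)} > 0"
proof -
  have "falling_factorial (real N - 1) k > 0"
    unfolding falling_factorial_def using k_less by (intro prod_pos) auto
  then show ?thesis
    using k_less by (simp add: prob_first_repeat_gt)
qed

text \<open>
  In the quotient of \<open>P(R = k + j)\<close> and \<open>P(R > k)\<close> the first \<open>k\<close> factors of the falling factorials
  cancel.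
\<close>

lemma cond_prob_first_repeat:
  "\<P>(\<omega> in M. first_repeat (traj \<omega>) - k = j \<bar> first_repeat (traj \<omega>) > k) =
     (if j \<in> {1..N - k} then stop_weight j else 0)"
proof (cases "j \<in> {1..N - k}")
  case True
  then obtain i where j: "j = Suc i" and i: "k + i < N"
    using k_less by (cases j) auto
  have "{\<omega> \<in> space M. first_repeat (traj \<omega>) - k = j \<and> first_repeat (traj \<omega>) > k} =
      {\<omega> \<in> space M. first_repeat (traj \<omega>) = Suc (k + i)}"
    using j by auto
  then have "\<P>(\<omega> in M. first_repeat (traj \<omega>) - k = j \<bar> first_repeat (traj \<omega>) > k) =
      real (Suc (k + i)) * falling_factorial (real N - 1) (k + i) / real N ^ Suc (k + i) /
      (falling_factorial (real N - 1) k / real N ^ k)"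
    using k_less by (simp add: cond_prob_def prob_first_repeat_eq_Suc[OF i] prob_first_repeat_gt)
  also have "\<dots> = stop_weight j"
  proof -
    have "falling_factorial (real N - 1) k / real N ^ k > 0"
      using prob_first_repeat_gt_pos k_less by (simp add: prob_first_repeat_gt)
    then have nz: "falling_factorial (real N - 1) k \<noteq> 0" "real N \<noteq> 0"
      using k_less by auto
    have shift: "real N - 1 - real k = real N - real k - 1"
      by simp
    have split: "falling_factorial (real N - 1) (k + i) =
        falling_factorial (real N - 1) k * falling_factorial (real N - real k - 1) i"
      unfolding falling_factorial_add shift ..
    show ?thesis
      unfolding stop_weight_def split using nz by (simp add: j power_add field_simps)
  qed
  finally show ?thesis
    using True by simp
next
  case False
  have "AE \<omega> in M. \<not> (first_repeat (traj \<omega>) - k = j \<and> first_repeat (traj \<omega>) > k)"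
    using AE_admissible
  proof eventually_elim
    fix \<omega> assume "admissible (traj \<omega>)"
    then have "\<not> N < first_repeat (traj \<omega>)"
      by (simp only: first_repeat_gt_iff not_inj_on_atMost_N not_False_eq_True)
    then show "\<not> (first_repeat (traj \<omega>) - k = j \<and> first_repeat (traj \<omega>) > k)"
      using False by auto
  qed
  then have "prob {\<omega> \<in> space M. first_repeat (traj \<omega>) - k = j \<and> first_repeat (traj \<omega>) > k} = 0"
    by (simp add: measure_def emeasure_eq_0_AE)
  then show ?thesis
    unfolding cond_prob_def if_not_P[OF False] by simp
qed

lemma prob_stopped_length:
  "prob {\<omega> \<in> space M. stopped_length k (traj \<omega>) = j} =
     (if j \<in> {1..N - k} then stop_weight j else 0)"
  using prob_length_and_changes[of "{}" j] by simp

lemma distr_stopped_length: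
  "distr M (count_space UNIV) (\<lambda>\<omega>. stopped_length k (traj \<omega>)) =
     distr (uniform_measure M {\<omega> \<in> space M. first_repeat (traj \<omega>) > k})
       (count_space UNIV) (\<lambda>\<omega>. first_repeat (traj \<omega>) - k)"
    (is "?L = distr ?U _ _")
proof (rule measure_eqI_countable)
  have L: "(\<lambda>\<omega>. stopped_length k (traj \<omega>)) \<in> measurable M (count_space UNIV)"
    using stopped_length_sets
    by (simp add: measurable_count_space_eq2_countable vimage_def Int_def conj_commute)
  have R: "(\<lambda>\<omega>. first_repeat (traj \<omega>) - k) \<in> measurable ?U (count_space UNIV)"
    by measurable
  have A: "{\<omega> \<in> space M. first_repeat (traj \<omega>) > k} \<in> events"
    by measurable
  interpret U: prob_space ?U
    by (rule prob_space_uniform_measure) (use prob_first_repeat_gt_pos in \<open>auto simp: emeasure_eq_measure\<close>)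
  fix j :: nat
  have "emeasure ?L {j} = prob {\<omega> \<in> space M. stopped_length k (traj \<omega>) = j}"
    using L by (simp add: emeasure_distr emeasure_eq_measure vimage_def Int_def conj_commute)
  also have "\<dots> = \<P>(\<omega> in ?U. first_repeat (traj \<omega>) - k = j)"
    unfolding prob_stopped_length cond_prob_first_repeat[symmetric]
    by (subst measure_uniform_measure_eq_cond_prob) measurable
  also have "\<dots> = emeasure (distr ?U (count_space UNIV) (\<lambda>\<omega>. first_repeat (traj \<omega>) - k)) {j}"
    using R by (simp add: emeasure_distr U.emeasure_eq_measure vimage_def Int_def conj_commute)
  finally show "emeasure ?L {j} =
      emeasure (distr ?U (count_space UNIV) (\<lambda>\<omega>. first_repeat (traj \<omega>) - k)) {j}" .
qed auto

lemma stop_weight_pos: "j \<in> {1..N - k} \<Longrightarrow> 0 < stop_weight j"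
  using k_less unfolding stop_weight_def falling_factorial_def
  by (intro divide_pos_pos mult_pos_pos prod_pos) auto

lemma changes_given_length:
  assumes j: "j \<in> {1..N - k}" and J: "J \<subseteq> {1..j - 1}"
  shows "\<P>(\<omega> in M. \<forall>i\<in>J. colour_change k (traj \<omega>) i \<bar> stopped_length k (traj \<omega>) = j) =
    (\<Prod>i\<in>J. 1 / real (k + i + 1))"
  using prob_length_and_changes[OF J] prob_stopped_length[of j] stop_weight_pos[OF j] j
  by (simp add: cond_prob_def conj_commute)

lemma indep_changes_given_length:
  assumes j: "j \<in> {1..N - k}"
  shows "prob_space.indep_events
    (uniform_measure M {\<omega> \<in> space M. stopped_length k (traj \<omega>) = j})
    (\<lambda>i. {\<omega> \<in> space M. colour_change k (traj \<omega>) i}) {1..j - 1}"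
proof -
  let ?U = "uniform_measure M {\<omega> \<in> space M. stopped_length k (traj \<omega>) = j}"
  have pos: "prob {\<omega> \<in> space M. stopped_length k (traj \<omega>) = j} > 0"
    using j stop_weight_pos[OF j] by (simp add: prob_stopped_length)
  interpret U: prob_space ?U
    by (rule prob_space_uniform_measure) (use pos in \<open>auto simp: emeasure_eq_measure\<close>)
  have prob_U: "U.prob {\<omega> \<in> space M. \<forall>i\<in>J. colour_change k (traj \<omega>) i} =
      (\<Prod>i\<in>J. 1 / real (k + i + 1))" if J: "J \<subseteq> {1..j - 1}" for J
  proof -
    have "finite J"
      using J finite_subset by blast
    then have "{\<omega> \<in> space M. \<forall>i\<in>J. colour_change k (traj \<omega>) i} \<in> events"
      using colour_change_sets by (intro sets.sets_Collect_finite_All) auto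
    then have "U.prob {\<omega> \<in> space M. \<forall>i\<in>J. colour_change k (traj \<omega>) i} =
        \<P>(\<omega> in M. \<forall>i\<in>J. colour_change k (traj \<omega>) i \<bar> stopped_length k (traj \<omega>) = j)"
      using stopped_length_sets
      by (subst measure_uniform_measure_eq_cond_prob[symmetric]) (auto simp: pred_def)
    then show ?thesis
      by (simp add: changes_given_length[OF j J])
  qed
  show ?thesis
  proof (rule U.indep_eventsI)
    show "{\<omega> \<in> space M. colour_change k (traj \<omega>) i} \<in> U.events" for i
      by (simp add: colour_change_sets)
    fix J assume J: "J \<subseteq> {1..j - 1}" "finite J" "J \<noteq> {}"
    have "(\<Inter>i\<in>J. {\<omega> \<in> space M. colour_change k (traj \<omega>) i}) =
        {\<omega> \<in> space M. \<forall>i\<in>J. colour_change k (traj \<omega>) i}"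
      using J(3) by auto
    then have "U.prob (\<Inter>i\<in>J. {\<omega> \<in> space M. colour_change k (traj \<omega>) i}) =
        (\<Prod>i\<in>J. 1 / real (k + i + 1))"
      by (simp add: prob_U[OF J(1)])
    also have "\<dots> = (\<Prod>i\<in>J. U.prob {\<omega> \<in> space M. colour_change k (traj \<omega>) i})"
    proof (rule prod.cong[OF refl])
      fix i assume "i \<in> J"
      then show "1 / real (k + i + 1) = U.prob {\<omega> \<in> space M. colour_change k (traj \<omega>) i}"
        using prob_U[of "{i}"] J(1) by auto
    qed
    finally show "U.prob (\<Inter>i\<in>J. {\<omega> \<in> space M. colour_change k (traj \<omega>) i}) =
        (\<Prod>i\<in>J. U.prob {\<omega> \<in> space M. colour_change k (traj \<omega>) i})" .
  qed
qed

end

theorem theorem1: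
  fixes N k :: nat and M :: "'a measure" and X :: "nat \<Rightarrow> 'a \<Rightarrow> nat"
  assumes "N \<ge> 2" and "1 \<le> k" and "k \<le> N - 1"
    and "prob_space M"
    and "\<forall>\<omega>\<in>space M. X 0 \<omega> = N"
    and "prob_space.indep_vars M (\<lambda>_. count_space UNIV) X {1..}"
    and "\<forall>n\<ge>1. distr M (count_space UNIV) (X n) = measure_pmf (pmf_of_set {1..N})"
  shows
    "distr M (count_space UNIV) (\<lambda>\<omega>. stopped_length k (\<lambda>n. X n \<omega>)) =
       distr (uniform_measure M {\<omega>\<in>space M. first_repeat (\<lambda>n. X n \<omega>) > k})
         (count_space UNIV) (\<lambda>\<omega>. first_repeat (\<lambda>n. X n \<omega>) - k)
     \<and> (\<forall>j\<in>{1..N - k}.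
         \<P>(\<omega> in M. stopped_length k (\<lambda>n. X n \<omega>) = j) =
           \<P>(\<omega> in M. first_repeat (\<lambda>n. X n \<omega>) - k = j \<bar> first_repeat (\<lambda>n. X n \<omega>) > k)
         \<and> \<P>(\<omega> in M. first_repeat (\<lambda>n. X n \<omega>) - k = j \<bar> first_repeat (\<lambda>n. X n \<omega>) > k) =
           real (k + j) * falling_factorial (real N - real k - 1) (j - 1) / real N ^ j)
     \<and> (\<forall>j\<in>{1..N - k}.
         prob_space.indep_events
           (uniform_measure M {\<omega>\<in>space M. stopped_length k (\<lambda>n. X n \<omega>) = j})
           (\<lambda>i. {\<omega>\<in>space M. colour_change k (\<lambda>n. X n \<omega>) i}) {1..j - 1}
         \<and> (\<forall>i\<in>{1..j - 1}.
             \<P>(\<omega> in M. colour_change k (\<lambda>n. X n \<omega>) i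
                 \<bar> stopped_length k (\<lambda>n. X n \<omega>) = j) = 1 / real (k + i + 1)))"
proof -
  interpret prob_space M
    by fact
  interpret uniform_walk N k M X
    by unfold_locales (use assms in auto)
  have change: "\<P>(\<omega> in M. colour_change k (\<lambda>n. X n \<omega>) i \<bar> stopped_length k (\<lambda>n. X n \<omega>) = j) =
      1 / real (k + i + 1)" if "j \<in> {1..N - k}" "i \<in> {1..j - 1}" for i j
    using changes_given_length[OF that(1), of "{i}"] that(2) by simp
  show ?thesis
    using distr_stopped_length indep_changes_given_length change
    by (simp add: prob_stopped_length cond_prob_first_repeat stop_weight_def)
qed

end
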